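(* Let $m\ge1$, $n_1,\dots,n_m\ge1$, and $\mathbb{X}=\biguplus_{r=1}^{m}\{r\}\times\mathbb{R}^{n_r}$. Suppose the predicted density on $\mathbb{X}$ at time $k$ is $f_{k|k-1}(r_k,x_k)=f_{k|k-1}(r_k)f_{k|k-1}(x_k|r_k)$ with $f_{k|k-1}(r_k)=\sum_{r_{k-1}=1}^{m}\mu(r_k|r_{k-1})f_{k-1|k-1}(r_{k-1})$ and Gaussian mixture state density for each mode $$f_{k|k-1}(x_k|r_k)=\sum_{r_{k-1}=1}^{m}\alpha_{k|k-1}^{(r_k,r_{k-1})}\,\mathcal{N}\big(x_k;\overline{x}_{k|k-1}^{(r_k,r_{k-1})},P_{k|k-1}^{(r_k,r_{k-1})}\big),\qquad \alpha_{k|k-1}^{(r_k,r_{k-1})}=\frac{\mu(r_k|r_{k-1})f_{k-1|k-1}(r_{k-1})}{\sum_{r'=1}^{m}\mu(r_k|r')f_{k-1|k-1}(r')},$$ and that the measurement $z_k\in\mathbb{R}^{n_z}$ has likelihood $l(z_k|r_k,x_k)=\mathcal{N}\big(z_k;H^{(r_k)}x_k+d^{(r_k)},R^{(r_k)}\big)$. Let $f_{k|k}$ be the exact Bayesian posterior density on $\mathbb{X}$. Then, among all densities $q$ on $\mathbb{X}$ of the form $q(r_k,x_k)=q(r_k)q(x_k|r_k)$ with $q(\cdot|r_k)$ a Gaussian density on $\mathbb{R}^{n_{r_k}}$ for each mode $r_k$, the Kullback–Leibler divergence $D(f_{k|k}\|q)$ is minimised by the density with $q(x_k|r_k)=\mathcal{N}\big(x_k;\overline{x}_{k|k}^{(r_k)},P_{k|k}^{(r_k)}\big)$,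 where $$\overline{x}_{k|k}^{(r_k)}=\sum_{r_{k-1}=1}^{m}\rho^{(r_k,r_{k-1})}\,\overline{x}_{k|k}^{(r_k,r_{k-1})},$$ $$P_{k|k}^{(r_k)}=\sum_{r_{k-1}=1}^{m}\rho^{(r_k,r_{k-1})}\big(\overline{x}_{k|k}^{(r_k,r_{k-1})}-\overline{x}_{k|k}^{(r_k)}\big)\big(\overline{x}_{k|k}^{(r_k,r_{k-1})}-\overline{x}_{k|k}^{(r_k)}\big)^{T}+\sum_{r_{k-1}=1}^{m}\rho^{(r_k,r_{k-1})}P_{k|k}^{(r_k,r_{k-1})},$$ with $$\overline{x}_{k|k}^{(r_k,r_{k-1})}=\overline{x}_{k|k-1}^{(r_k,r_{k-1})}+P_{k|k-1}^{(r_k,r_{k-1})}\big(H^{(r_k)}\big)^{T}\big(S^{(r_k,r_{k-1})}\big)^{-1}\big(z_k-\hat z^{(r_k,r_{k-1})}\big),$$ $$P_{k|k}^{(r_k,r_{k-1})}=P_{k|k-1}^{(r_k,r_{k-1})}-P_{k|k-1}^{(r_k,r_{k-1})}\big(H^{(r_k)}\big)^{T}\big(S^{(r_k,r_{k-1})}\big)^{-1}H^{(r_k)}P_{k|k-1}^{(r_k,r_{k-1})},$$ $$\hat z^{(r_k,r_{k-1})}=H^{(r_k)}\overline{x}_{k|k-1}^{(r_k,r_{k-1})}+d^{(r_k)},\qquad S^{(r_k,r_{k-1})}=H^{(r_k)}P_{k|k-1}^{(r_k,r_{k-1})}\big(H^{(r_k)}\big)^{T}+R^{(r_k)},$$ $$\tilde\rho^{(r_k,r_{k-1})}=\mathcal{N}\big(z_k;\hat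 z^{(r_k,r_{k-1})},S^{(r_k,r_{k-1})}\big)\,\mu(r_k|r_{k-1})\,f_{k-1|k-1}(r_{k-1}),\qquad \rho^{(r_k,r_{k-1})}=\frac{\tilde\rho^{(r_k,r_{k-1})}}{\sum_{r'=1}^{m}\tilde\rho^{(r_k,r')}},$$ and with mode probabilities $q(r_k)=f_{k|k}(r_k)$, the posterior of the mode, given by $$f_{k|k}(r_k)=\frac{\sum_{r_{k-1}=1}^{m}\tilde\rho^{(r_k,r_{k-1})}}{\sum_{r=1}^{m}\sum_{r_{k-1}=1}^{m}\tilde\rho^{(r,r_{k-1})}}.$$
   Context: The target state is $\tilde x=(r,x)\in\mathbb{X}$ with mode $r\in\{1,\dots,m\}$ and kinematic state $x\in\mathbb{R}^{n_r}$; the dimensions $n_r$ may differ between modes. The integral of a function $g$ on $\mathbb{X}$ is $\int_{\mathbb{X}}g(\tilde x)\,d\tilde x=\sum_{r=1}^m\int_{\mathbb{R}^{n_r}}g(r,x)\,dx$. A density on $\mathbb{X}$ is a nonnegative function with integral one; $g(r)=\int g(r,x)\,dx$ is its mode marginal and $g(x|r)$ the conditional density of the state given the mode. Formulas for quantities conditioned on a mode $r_k$ are asserted for those $r_k$ with $f_{k|k-1}(r_k)>0$ (for other modes the conditional is irrelevant). $\mathcal{N}(x;\bar x,P)$ denotes the Gaussian density with mean $\bar x$ and covariance matrix $P$ (symmetric positive definite) evaluated at $x$. $H^{(r)}\in\mathbb{R}^{n_z\times n_r}$, $d^{(r)}\in\mathbb{R}^{n_z}$, $R^{(r)}\in\mathbb{R}^{n_z\times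 n_z}$. $f_{k-1|k-1}(\cdot)$ is the probability mass function on $\{1,\dots,m\}$ of the mode at time $k-1$ and $\mu(\cdot|r_{k-1})$ is a probability mass function on $\{1,\dots,m\}$ for each $r_{k-1}$ (mode transition). The mixture parameters come from a linear Gaussian prediction of mode-conditioned Gaussians $\mathcal{N}(\cdot;\overline{x}_{k-1|k-1}^{(r_{k-1})},P_{k-1|k-1}^{(r_{k-1})})$ on $\mathbb{R}^{n_{r_{k-1}}}$: $\overline{x}_{k|k-1}^{(r_k,r_{k-1})}=F^{(r_k,r_{k-1})}\overline{x}_{k-1|k-1}^{(r_{k-1})}+b^{(r_k,r_{k-1})}$ and $P_{k|k-1}^{(r_k,r_{k-1})}=F^{(r_k,r_{k-1})}P_{k-1|k-1}^{(r_{k-1})}(F^{(r_k,r_{k-1})})^{T}+Q^{(r_k,r_{k-1})}$, with $F^{(r_k,r_{k-1})}\in\mathbb{R}^{n_{r_k}\times n_{r_{k-1}}}$, $b^{(r_k,r_{k-1})}\in\mathbb{R}^{n_{r_k}}$, $Q^{(r_k,r_{k-1})}\in\mathbb{R}^{n_{r_k}\times n_{r_k}}$. The exact posterior is given by Bayes' rule on $\mathbb{X}$: $f_{k|k}(r_k,x_k)=\dfrac{l(z_k|r_k,x_k)f_{k|k-1}(r_k,x_k)}{\sum_{r=1}^m\int_{\mathbb{R}^{n_r}}l(z_k|r,x)f_{k|k-1}(r,x)\,dx}$. The Kullback–Leibler divergence between densities $\pi,q$ on $\mathbb{X}$ is $D(\pi\|q)=\int_{\mathbb{X}}\pi(\tilde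 x)\log\frac{\pi(\tilde x)}{q(\tilde x)}\,d\tilde x=\sum_{r=1}^m\int_{\mathbb{R}^{n_r}}\pi(r,x)\log\frac{\pi(r,x)}{q(r,x)}\,dx$, with $0\log 0=0$. (The density $q$ is the updated density used by the "VD-GPB2 filter".) *)

theory Defs
  imports
    "HOL-Probability.Probability"
    "Jordan_Normal_Form.Determinant"
    "Jordan_Normal_Form.Gauss_Jordan_Elimination"
begin

(* The state dimension depends on the mode, so vectors and matrices are the ones with an explicit
   dimension (carrier_vec, carrier_mat). HOL-Analysis uses some of the same names and symbols. *)
unbundle no vec_syntax
unbundle no inner_syntax
hide_const (open) Finite_Cartesian_Product.mat Finite_Cartesian_Product.vec
  Finite_Cartesian_Product.row Finite_Cartesian_Product.rows Finite_Cartesian_Product.column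
  Finite_Cartesian_Product.columns Determinants.det
hide_type (open) Finite_Cartesian_Product.vec

definition pos_def_mat :: "nat \<Rightarrow> real mat \<Rightarrow> bool" where
  "pos_def_mat n A \<longleftrightarrow>
     A \<in> carrier_mat n n \<and> transpose_mat A = A \<and>
     (\<forall>v\<in>carrier_vec n. v \<noteq> 0\<^sub>v n \<longrightarrow> 0 < v \<bullet> (A *\<^sub>v v))"

(* Meaningful for invertible A only: mat_inverse returns None on singular matrices. *)
definition inv_mat :: "real mat \<Rightarrow> real mat" where
  "inv_mat A = the (mat_inverse A)"

definition outer_prod :: "real vec \<Rightarrow> real vec \<Rightarrow> real mat" where
  "outer_prod v w = mat (dim_vec v) (dim_vec w) (\<lambda>(i, j). v $ i * w $ j)"

definition vec_family_sum :: "nat \<Rightarrow> ('i \<Rightarrow> real vec) \<Rightarrow> 'i set \<Rightarrow> real vec" where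
  "vec_family_sum n f I = vec n (\<lambda>i. \<Sum>a\<in>I. f a $ i)"

definition mat_family_sum :: "nat \<Rightarrow> nat \<Rightarrow> ('i \<Rightarrow> real mat) \<Rightarrow> 'i set \<Rightarrow> real mat" where
  "mat_family_sum nr nc f I = mat nr nc (\<lambda>(i, j). \<Sum>a\<in>I. f a $$ (i, j))"

(* Lebesgue measure on the Borel sets of R^n, carried over from the n-fold product measure on
   extensional functions {..<n} -> R by the bijection "vec n" onto carrier_vec n. *)
definition lborel_vec :: "nat \<Rightarrow> real vec measure" where
  "lborel_vec n = embed_measure (\<Pi>\<^sub>M i\<in>{..<n}. (lborel :: real measure)) (vec n)"

definition gauss :: "real vec \<Rightarrow> real vec \<Rightarrow> real mat \<Rightarrow> real" where
  "gauss x a P =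
     exp (- ((x - a) \<bullet> (inv_mat P *\<^sub>v (x - a))) / 2) / sqrt ((2 * pi) ^ dim_vec x * det P)"

definition gaussian_density_vec :: "nat \<Rightarrow> (real vec \<Rightarrow> real) \<Rightarrow> bool" where
  "gaussian_density_vec n g \<longleftrightarrow>
     (\<exists>a P. a \<in> carrier_vec n \<and> pos_def_mat n P \<and> (\<forall>x\<in>carrier_vec n. g x = gauss x a P))"

(* In what follows the state space is the disjoint union of {r} x R^(n r) over the modes r in {1..m}.
   Functions on it are curried; their values outside of it are irrelevant. *)

definition nn_integral_states ::
    "nat \<Rightarrow> (nat \<Rightarrow> nat) \<Rightarrow> (nat \<Rightarrow> real vec \<Rightarrow> ennreal) \<Rightarrow> ennreal" where
  "nn_integral_states m n g = (\<Sum>r=1..m. \<integral>\<^sup>+x. g r x \<partial>lborel_vec (n r))"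

definition state_density :: "nat \<Rightarrow> (nat \<Rightarrow> nat) \<Rightarrow> (nat \<Rightarrow> real vec \<Rightarrow> real) \<Rightarrow> bool" where
  "state_density m n q \<longleftrightarrow>
     (\<forall>r\<in>{1..m}. q r \<in> borel_measurable (lborel_vec (n r))) \<and>
     (\<forall>r\<in>{1..m}. \<forall>x\<in>carrier_vec (n r). 0 \<le> q r x) \<and>
     nn_integral_states m n (\<lambda>r x. ennreal (q r x)) = 1"

definition mode_marginal :: "(nat \<Rightarrow> nat) \<Rightarrow> (nat \<Rightarrow> real vec \<Rightarrow> real) \<Rightarrow> nat \<Rightarrow> real" where
  "mode_marginal n q r = (\<integral>x. q r x \<partial>lborel_vec (n r))"

definition mode_gaussian_density ::
    "nat \<Rightarrow> (nat \<Rightarrow> nat) \<Rightarrow> (nat \<Rightarrow> real vec \<Rightarrow> real) \<Rightarrow> bool" where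
  "mode_gaussian_density m n q \<longleftrightarrow>
     state_density m n q \<and>
     (\<exists>\<kappa>. \<forall>r\<in>{1..m}. gaussian_density_vec (n r) (\<kappa> r) \<and>
        (\<forall>x\<in>carrier_vec (n r). q r x = mode_marginal n q r * \<kappa> r x))"

(* The infinite value is needed because ln 0 = 0 and t / 0 = 0: a density q that
   vanishes where p does not must have infinite divergence. *)
definition kl_integrand :: "real \<Rightarrow> real \<Rightarrow> ereal" where
  "kl_integrand p q = (if p = 0 then 0 else if q = 0 then \<infinity> else ereal (p * ln (p / q)))"

(* Integral of the positive part minus integral of the negative part (e2ennreal truncates negative
   values to 0). For densities p, q the second integral is finite. *)
definition KL_states ::
    "nat \<Rightarrow> (nat \<Rightarrow> nat) \<Rightarrow> (nat \<Rightarrow> real vec \<Rightarrow> real) \<Rightarrow> (nat \<Rightarrow> real vec \<Rightarrow> real) \<Rightarrow> ereal" where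
  "KL_states m n p q =
     enn2ereal (nn_integral_states m n (\<lambda>r x. e2ennreal (kl_integrand (p r x) (q r x)))) -
     enn2ereal (nn_integral_states m n (\<lambda>r x. e2ennreal (- kl_integrand (p r x) (q r x))))"

end

theory Submission
  imports Defs
begin

text \<open>By Kalman's formulas, likelihood times predicted density is, in each mode, a Gaussian mixture
  with unnormalised weights \<open>\<rho>'\<close>; this gives the posterior of the mode. The logarithm of a ratio of
  two Gaussian densities is a quadratic polynomial, and the moment matched density \<open>q_opt\<close> gives
  quadratic polynomials the same integral as the posterior. Hence for every competitor \<open>y\<close> the
  divergence splits as \<open>D(f_post\<parallel>y) = D(f_post\<parallel>q_opt) + D(q_opt\<parallel>y)\<close>, where the last term is
  nonnegative. The Gaussian moments come from the substitution \<open>x = a + L w\<close> with the triangular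
  Cholesky factor \<open>L\<close> of the covariance, one coordinate at a time.\<close>

section \<open>Positive definite matrices\<close>

text \<open>The logarithm of a mixture has no closed form, so \<open>D(f_post||q_opt)\<close> is
  never evaluated; only its difference to the competitor's divergence is controlled, and infinite
  values have to be allowed on the way. The mode probabilities need no separate optimisation: the
  ratio of two mode weights merely adds a constant to the log ratio inside each mode, so weights and
  Gaussians are compared by one Gibbs inequality on the whole hybrid space. Two degenerate
  situations shape the argument. In a mode of posterior weight 0 the weights \<open>\<rho>\<close>
  are divisions by 0 and \<open>Pbar\<close> need not be a covariance matrix, but there posterior
  and approximation both vanish. Conversely, a competitor may omit a mode that the posterior
  charges, and then its divergence is infinite. The Kalman identities are proved by applying
  matrices to vectors and using symmetry, which avoids any formula for the inverse of the updated
  covariance.\<close>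

lemma inv_mat_inverse:
  assumes "A \<in> carrier_mat n n" "det A \<noteq> 0"
  shows "inv_mat A \<in> carrier_mat n n" "A * inv_mat A = 1\<^sub>m n" "inv_mat A * A = 1\<^sub>m n"
proof -
  have "A \<in> Units (ring_mat TYPE(real) n undefined)"
    using det_non_zero_imp_unit[OF assms] .
  then obtain B where "mat_inverse A = Some B"
    using mat_inverse(1)[OF assms(1), of undefined] by (cases "mat_inverse A") auto
  with mat_inverse(2)[OF assms(1) this]
  show "inv_mat A \<in> carrier_mat n n" "A * inv_mat A = 1\<^sub>m n" "inv_mat A * A = 1\<^sub>m n"
    by (auto simp: inv_mat_def)
qed

lemma pos_def_matD:
  assumes "pos_def_mat n A"
  shows "A \<in> carrier_mat n n" "transpose_mat A = A"
    "\<And>v. v \<in> carrier_vec n \<Longrightarrow> v \<noteq> 0\<^sub>v n \<Longrightarrow> 0 < v \<bullet> (A *\<^sub>v v)"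
  using assms by (auto simp: pos_def_mat_def)

lemma pos_def_mat_nonneg:
  assumes "pos_def_mat n A" "v \<in> carrier_vec n"
  shows "0 \<le> v \<bullet> (A *\<^sub>v v)"
  using pos_def_matD[OF assms(1)] assms(2) by (cases "v = 0\<^sub>v n") (auto intro: less_imp_le)

lemma pos_def_mat_sym_index:
  assumes "pos_def_mat n A" "i < n" "j < n"
  shows "A $$ (i, j) = A $$ (j, i)"
  using pos_def_matD(1,2)[OF assms(1)] assms(2,3) by (metis carrier_matD index_transpose_mat(1))

lemma pos_def_mat_det_nonzero:
  assumes "pos_def_mat n A"
  shows "det A \<noteq> 0"
proof
  assume "det A = 0"
  then obtain v where v: "v \<in> carrier_vec n" "v \<noteq> 0\<^sub>v n" "A *\<^sub>v v = 0\<^sub>v n"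
    using det_0_iff_vec_prod_zero[OF pos_def_matD(1)[OF assms]] by auto
  with pos_def_matD(3)[OF assms v(1,2)] show False by simp
qed

lemmas pos_def_inv = inv_mat_inverse[OF pos_def_matD(1) pos_def_mat_det_nonzero]

lemma pos_def_inv_vec:
  assumes "pos_def_mat n A" "v \<in> carrier_vec n"
  shows "A *\<^sub>v (inv_mat A *\<^sub>v v) = v" "inv_mat A *\<^sub>v (A *\<^sub>v v) = v"
  using pos_def_inv[OF assms(1,1)] pos_def_matD(1)[OF assms(1)] assms(2)
  by (metis assoc_mult_mat_vec one_mult_mat_vec)+

lemma scalar_prod_sym_mat:
  fixes A :: "real mat"
  assumes "A \<in> carrier_mat n n" "transpose_mat A = A" "v \<in> carrier_vec n" "w \<in> carrier_vec n"
  shows "(A *\<^sub>v v) \<bullet> w = v \<bullet> (A *\<^sub>v w)"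
  using transpose_vec_mult_scalar[OF assms(1,4,3)] assms(2) by simp

text \<open>The sum over entries is the form in which test vectors are padded by one coordinate,
  sums over mixture components are interchanged, and integrals are taken term by term.\<close>

lemma quad_form_sum:
  fixes A :: "real mat"
  assumes "A \<in> carrier_mat n n" "v \<in> carrier_vec n"
  shows "v \<bullet> (A *\<^sub>v v) = (\<Sum>i<n. \<Sum>j<n. A $$ (i, j) * (v $ i * v $ j))"
  using assms
  by (auto simp: scalar_prod_def atLeast0LessThan sum_distrib_left mult_ac intro!: sum.cong)

text \<open>A test vector padded with a final zero has the same value under \<open>P\<close> as the
  short vector under the leading block.\<close>

lemma pos_def_mat_leading:
  assumes "pos_def_mat (Suc n) P"
  shows "pos_def_mat n (mat n n (\<lambda>ij. P $$ ij))"
  unfolding pos_def_mat_def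
proof (intro conjI ballI impI)
  let ?A = "mat n n (\<lambda>ij. P $$ ij)"
  show "?A \<in> carrier_mat n n" by simp
  show "transpose_mat ?A = ?A"
    by (rule eq_matI) (auto simp: pos_def_mat_sym_index[OF assms])
  fix v :: "real vec" assume v: "v \<in> carrier_vec n" "v \<noteq> 0\<^sub>v n"
  define x where "x = vec (Suc n) (\<lambda>i. if i < n then v $ i else 0)"
  have x: "x \<in> carrier_vec (Suc n)" by (simp add: x_def)
  from v obtain i where "i < n" "v $ i \<noteq> 0" by (auto simp: vec_eq_iff)
  then have "x $ i \<noteq> 0" "i < Suc n" by (auto simp: x_def)
  then have "x \<noteq> 0\<^sub>v (Suc n)" by (auto simp del: index_zero_vec) (auto simp: x_def)
  from pos_def_matD(3)[OF assms x this]
  show "0 < v \<bullet> (?A *\<^sub>v v)"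
    unfolding quad_form_sum[OF pos_def_matD(1)[OF assms] x] quad_form_sum[OF \<open>?A \<in> _\<close> v(1)]
    by (simp add: x_def)
qed

text \<open>The Schur complement \<open>s\<close> below is the value of the quadratic form of \<open>P\<close> at
  \<open>(- u, 1)\<close>, hence positive.\<close>
lemma cholesky:
  assumes "pos_def_mat n P"
  shows "\<exists>L\<in>carrier_mat n n. (\<forall>i j. i < j \<longrightarrow> j < n \<longrightarrow> L $$ (i, j) = 0) \<and>
           (\<forall>i<n. 0 < L $$ (i, i)) \<and> P = L * transpose_mat L"
  using assms
proof (induction n arbitrary: P)
  case 0
  have "P = 1\<^sub>m 0 * transpose_mat (1\<^sub>m 0)"
    using pos_def_matD(1)[OF 0] by (intro eq_matI) auto
  then show ?case by (intro bexI[of _ "1\<^sub>m 0"]) auto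
next
  case (Suc n)
  define A where "A = mat n n (\<lambda>ij. P $$ ij)"
  note P = pos_def_matD(1)[OF Suc.prems]
  have sym: "P $$ (n, j) = P $$ (j, n)" if "j < n" for j
    using pos_def_mat_sym_index[OF Suc.prems, of n j] that by simp
  have A: "pos_def_mat n A"
    using pos_def_mat_leading[OF Suc.prems] by (simp add: A_def)
  from Suc.IH[OF A] obtain K where K: "K \<in> carrier_mat n n"
    and low: "\<And>i j. i < j \<Longrightarrow> j < n \<Longrightarrow> K $$ (i, j) = 0"
    and diag: "\<And>i. i < n \<Longrightarrow> 0 < K $$ (i, i)" and AK: "A = K * transpose_mat K" by auto
  define v where "v = vec n (\<lambda>i. P $$ (i, n))"
  have v: "v \<in> carrier_vec n" by (simp add: v_def)
  define u where "u = inv_mat A *\<^sub>v v"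
  have u: "u \<in> carrier_vec n" using pos_def_inv(1)[OF A A] v by (simp add: u_def)
  have Au: "A *\<^sub>v u = v" unfolding u_def by (rule pos_def_inv_vec[OF A v])
  \<comment> \<open>The last row of the new factor has to solve \<open>K w = v\<close>. As
    \<open>A = K K^T\<close> and \<open>A u = v\<close>, the vector \<open>K^T u\<close> does, and
    its squared length is exactly the term \<open>u \<bullet> v\<close> subtracted in the Schur
    complement.\<close>
  define w where "w = transpose_mat K *\<^sub>v u"
  have w: "w \<in> carrier_vec n" using K u by (simp add: w_def)
  have Kw: "K *\<^sub>v w = v"
    using Au AK K u unfolding w_def by (metis assoc_mult_mat_vec transpose_carrier_mat)
  have ww: "w \<bullet> w = u \<bullet> v"
    using transpose_vec_mult_scalar[OF K w u] Kw by (simp add: w_def)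
  define s where "s = P $$ (n, n) - u \<bullet> v"
  have s: "0 < s"
  proof -
    define x where "x = vec (Suc n) (\<lambda>i. if i < n then - (u $ i) else 1)"
    have x: "x \<in> carrier_vec (Suc n)" by (simp add: x_def)
    have "x $ n \<noteq> 0" by (simp add: x_def)
    then have "x \<noteq> 0\<^sub>v (Suc n)" by auto
    from pos_def_matD(3)[OF Suc.prems x this]
    have "0 < (\<Sum>i<Suc n. \<Sum>j<Suc n. P $$ (i, j) * (x $ i * x $ j))"
      unfolding quad_form_sum[OF P x] .
    also have "\<dots> = (\<Sum>i<n. \<Sum>j<n. A $$ (i, j) * (u $ i * u $ j)) - (\<Sum>i<n. v $ i * u $ i)
        - (\<Sum>i<n. v $ i * u $ i) + P $$ (n, n)"
      by (simp add: x_def A_def v_def sum.distrib sum_subtractf sum_negf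
          sym)
    also have "\<dots> = u \<bullet> (A *\<^sub>v u) - 2 * (u \<bullet> v) + P $$ (n, n)"
      using u v quad_form_sum[OF pos_def_matD(1)[OF A] u]
      by (simp add: scalar_prod_def atLeast0LessThan mult.commute)
    also have "\<dots> = s" using Au by (simp add: s_def)
    finally show ?thesis .
  qed
  define L where "L = mat (Suc n) (Suc n) (\<lambda>(i, j). if j < n then (if i < n then K $$ (i, j) else w $ j)
      else if i < n then 0 else sqrt s)"
  have L: "L \<in> carrier_mat (Suc n) (Suc n)" by (simp add: L_def)
  have "P = L * transpose_mat L"
  proof (rule eq_matI)
    show "dim_row P = dim_row (L * transpose_mat L)" "dim_col P = dim_col (L * transpose_mat L)"
      using P L by auto
    fix i j assume "i < dim_row (L * transpose_mat L)" "j < dim_col (L * transpose_mat L)"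
    then have ij: "i < Suc n" "j < Suc n" using L by auto
    have "(L * transpose_mat L) $$ (i, j) = (\<Sum>k<n. L $$ (i, k) * L $$ (j, k)) + L $$ (i, n) * L $$ (j, n)"
      using ij L by (simp add: scalar_prod_def atLeast0LessThan)
    also have "\<dots> = P $$ (i, j)"
    proof -
      have 1: "(\<Sum>k<n. K $$ (i, k) * K $$ (j, k)) = P $$ (i, j)" if "i < n" "j < n" for i j
      proof -
        have "P $$ (i, j) = A $$ (i, j)" using that by (simp add: A_def)
        then show ?thesis using that K by (simp add: AK scalar_prod_def atLeast0LessThan)
      qed
      have 2: "(\<Sum>k<n. K $$ (i, k) * w $ k) = P $$ (i, n)" if "i < n" for i
      proof -
        have "P $$ (i, n) = (K *\<^sub>v w) $ i" using that by (simp add: Kw v_def)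
        then show ?thesis using that K w by (simp add: scalar_prod_def atLeast0LessThan)
      qed
      have 3: "(\<Sum>k<n. w $ k * w $ k) + s = P $$ (n, n)"
        using ww w by (simp add: s_def scalar_prod_def atLeast0LessThan)
      have "i < n \<or> i = n" "j < n \<or> j = n" using ij by auto
      then show ?thesis
        using 1[of i j] 2[of i] 2[of j] 3 s sym[of j]
        by (auto simp: L_def mult.commute)
    qed
    finally show "P $$ (i, j) = (L * transpose_mat L) $$ (i, j)" by simp
  qed
  moreover have "\<forall>i j. i < j \<longrightarrow> j < Suc n \<longrightarrow> L $$ (i, j) = 0"
    using low by (auto simp: L_def)
  moreover have "\<forall>i<Suc n. 0 < L $$ (i, i)"
    using diag s by (auto simp: L_def less_Suc_eq)
  ultimately show ?case using L by blast
qed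

section \<open>The Kalman update\<close>

text \<open>By symmetry of \<open>A\<close> the transposed inverse is a left inverse of
  \<open>A\<close>, hence equal to the right inverse.\<close>

lemma inv_mat_sym:
  assumes "pos_def_mat n A"
  shows "transpose_mat (inv_mat A) = inv_mat A"
proof -
  note A = pos_def_matD(1,2)[OF assms] and B = pos_def_inv[OF assms assms]
  have "transpose_mat (inv_mat A) * A = 1\<^sub>m n"
    using transpose_mult[OF A(1) B(1)] A B by simp
  then have "transpose_mat (inv_mat A) * (A * inv_mat A) = inv_mat A"
    using A B by (metis assoc_mult_mat left_mult_one_mat transpose_carrier_mat)
  then show ?thesis using B by (metis right_mult_one_mat transpose_carrier_mat)
qed

context
  fixes n k :: nat and P H R S U :: "real mat"
  assumes P: "pos_def_mat n P" and H: "H \<in> carrier_mat k n" and R: "pos_def_mat k R"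
    and S_eq: "S = H * P * transpose_mat H + R"
    and U_eq: "U = P - P * transpose_mat H * inv_mat S * H * P"
begin

private lemma Pc: "P \<in> carrier_mat n n" and Rc: "R \<in> carrier_mat k k"
  and HTc: "transpose_mat H \<in> carrier_mat n k"
  using pos_def_matD(1)[OF P] pos_def_matD(1)[OF R] H by auto

private lemma Sc: "S \<in> carrier_mat k k"
  using Pc H Rc by (simp add: S_eq)

text \<open>Together with \<open>K_mult\<close> and \<open>U_mult\<close> this turns matrix products
  into nested applications to vectors, so that the computations below need only linearity and moving
  \<open>H\<close> across the scalar product.\<close>

private lemma S_mult:
  assumes "t \<in> carrier_vec k"
  shows "S *\<^sub>v t = H *\<^sub>v (P *\<^sub>v (transpose_mat H *\<^sub>v t)) + R *\<^sub>v t"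
proof -
  have "S *\<^sub>v t = (H * P * transpose_mat H) *\<^sub>v t + R *\<^sub>v t"
    unfolding S_eq using Pc H Rc assms by (intro add_mult_distrib_mat_vec[of _ k k]) auto
  also have "(H * P * transpose_mat H) *\<^sub>v t = (H * P) *\<^sub>v (transpose_mat H *\<^sub>v t)"
    using Pc H assms by (intro assoc_mult_mat_vec[of _ k n _ k]) auto
  also have "\<dots> = H *\<^sub>v (P *\<^sub>v (transpose_mat H *\<^sub>v t))"
    using Pc H assms by (intro assoc_mult_mat_vec[of _ k n _ n]) auto
  finally show ?thesis .
qed

text \<open>The form of \<open>S\<close> at \<open>t\<close> is the form of \<open>P\<close> at
  \<open>H^T t\<close> plus the form of \<open>R\<close> at \<open>t\<close>; only the second is
  known to be strictly positive.\<close>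

lemma pos_def_innovation: "pos_def_mat k S"
  unfolding pos_def_mat_def
proof (intro conjI ballI impI)
  show "S \<in> carrier_mat k k" by (rule Sc)
  have "transpose_mat (H * P * transpose_mat H) = H * P * transpose_mat H"
    using Pc H pos_def_matD(2)[OF P] transpose_mult[of H k n P n] transpose_mult[of "H * P" k n "transpose_mat H" k]
    by (simp add: assoc_mult_mat[of H k n P n "transpose_mat H" k])
  then show "transpose_mat S = S"
    unfolding S_eq using Pc H Rc pos_def_matD(2)[OF R]
      transpose_add[of "H * P * transpose_mat H" k k R] by simp
  fix t :: "real vec" assume t: "t \<in> carrier_vec k" "t \<noteq> 0\<^sub>v k"
  define y where "y = transpose_mat H *\<^sub>v t"
  have y: "y \<in> carrier_vec n" using H t by (simp add: y_def)
  have "t \<bullet> (S *\<^sub>v t) = t \<bullet> (H *\<^sub>v (P *\<^sub>v y)) + t \<bullet> (R *\<^sub>v t)"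
    unfolding S_mult[OF t(1)] y_def[symmetric]
    using t y Pc H Rc by (intro scalar_prod_add_distrib[of _ k]) auto
  also have "t \<bullet> (H *\<^sub>v (P *\<^sub>v y)) = y \<bullet> (P *\<^sub>v y)"
    using transpose_vec_mult_scalar[OF H, of "P *\<^sub>v y" t] y t Pc by (simp add: y_def)
  finally show "0 < t \<bullet> (S *\<^sub>v t)"
    using pos_def_mat_nonneg[OF P y] pos_def_matD(3)[OF R t] by simp
qed

private lemma Kc: "P * transpose_mat H * inv_mat S \<in> carrier_mat n k"
  by (rule mult_carrier_mat[OF mult_carrier_mat[OF Pc HTc]
        pos_def_inv(1)[OF pos_def_innovation pos_def_innovation]])

private lemma KHPc: "P * transpose_mat H * inv_mat S * H * P \<in> carrier_mat n n"
  by (rule mult_carrier_mat[OF mult_carrier_mat[OF Kc H] Pc])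

private lemma Uc: "U \<in> carrier_mat n n"
  unfolding U_eq by (rule minus_carrier_mat[OF KHPc])

private lemma K_mult:
  assumes "e \<in> carrier_vec k"
  shows "(P * transpose_mat H * inv_mat S) *\<^sub>v e
    = P *\<^sub>v (transpose_mat H *\<^sub>v (inv_mat S *\<^sub>v e))"
proof -
  note I = pos_def_inv(1)[OF pos_def_innovation pos_def_innovation]
  have "(P * transpose_mat H * inv_mat S) *\<^sub>v e = (P * transpose_mat H) *\<^sub>v (inv_mat S *\<^sub>v e)"
    using Pc HTc I assms by (intro assoc_mult_mat_vec[of _ n k _ k]) auto
  also have "\<dots> = P *\<^sub>v (transpose_mat H *\<^sub>v (inv_mat S *\<^sub>v e))"
    using Pc HTc I assms by (intro assoc_mult_mat_vec[of _ n n _ k]) auto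
  finally show ?thesis .
qed

private lemma U_mult:
  assumes "w \<in> carrier_vec n"
  shows "U *\<^sub>v w = P *\<^sub>v w - P *\<^sub>v (transpose_mat H *\<^sub>v (inv_mat S *\<^sub>v (H *\<^sub>v (P *\<^sub>v w))))"
proof -
  note I = pos_def_inv(1)[OF pos_def_innovation pos_def_innovation]
  have "U *\<^sub>v w = P *\<^sub>v w - (P * transpose_mat H * inv_mat S * H * P) *\<^sub>v w"
    unfolding U_eq using Pc H HTc I assms by (intro minus_mult_distrib_mat_vec[of _ n n]) auto
  also have "(P * transpose_mat H * inv_mat S * H * P) *\<^sub>v w
      = (P * transpose_mat H * inv_mat S * H) *\<^sub>v (P *\<^sub>v w)"
    using Pc H HTc I assms by (intro assoc_mult_mat_vec[of _ n n _ n]) auto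
  also have "\<dots> = (P * transpose_mat H * inv_mat S) *\<^sub>v (H *\<^sub>v (P *\<^sub>v w))"
    using Pc H HTc I assms by (intro assoc_mult_mat_vec[of _ n k _ n]) auto
  finally show ?thesis using K_mult[of "H *\<^sub>v (P *\<^sub>v w)"] H Pc assms by simp
qed

text \<open>This is the Joseph form \<open>U = (1 - K H) P (1 - K H)^T + K R K^T\<close> with gain
  \<open>K = P H^T S^-1\<close>, evaluated at \<open>w\<close>: here \<open>g = K^T w\<close> and
  \<open>q = H^T g\<close>. Both terms are nonnegative; the second is positive if \<open>g\<close>
  is nonzero, and otherwise the first is the form of \<open>P\<close> at \<open>w\<close>.\<close>

lemma pos_def_kalman_update: "pos_def_mat n U"
  unfolding pos_def_mat_def
proof (intro conjI ballI impI)
  note I = pos_def_inv(1)[OF pos_def_innovation pos_def_innovation]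
  show "U \<in> carrier_mat n n" by (rule Uc)
  have PT: "transpose_mat P = P" and IT: "transpose_mat (inv_mat S) = inv_mat S"
    using pos_def_matD(2)[OF P] inv_mat_sym[OF pos_def_innovation] by auto
  have "transpose_mat (P * transpose_mat H * inv_mat S * H * P)
      = P * (transpose_mat H * (inv_mat S * (H * P)))"
    using Pc H HTc I transpose_mult[of P n n "transpose_mat H" k]
      transpose_mult[of "P * transpose_mat H" n k "inv_mat S" k]
      transpose_mult[of "P * transpose_mat H * inv_mat S" n k H n]
      transpose_mult[of "P * transpose_mat H * inv_mat S * H" n n P n]
      mult_carrier_mat[OF Pc HTc] Kc mult_carrier_mat[OF Kc H]
    by (simp add: PT IT del: assoc_mult_mat)
  also have "\<dots> = P * transpose_mat H * inv_mat S * H * P"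
    using Pc H HTc I assoc_mult_mat[of P n n "transpose_mat H" k "inv_mat S * (H * P)" n]
      assoc_mult_mat[of "P * transpose_mat H" n k "inv_mat S" k "H * P" n]
      assoc_mult_mat[of "P * transpose_mat H * inv_mat S" n k H n P n]
    by simp
  finally show "transpose_mat U = U"
    unfolding U_eq transpose_minus[OF Pc KHPc] PT by simp
  fix w :: "real vec" assume w: "w \<in> carrier_vec n" "w \<noteq> 0\<^sub>v n"
  define g where "g = inv_mat S *\<^sub>v (H *\<^sub>v (P *\<^sub>v w))"
  have g: "g \<in> carrier_vec k" using I H Pc w by (simp add: g_def)
  define q where "q = transpose_mat H *\<^sub>v g"
  have q: "q \<in> carrier_vec n" using HTc g by (simp add: q_def)
  have Pw: "P *\<^sub>v w \<in> carrier_vec n" and Pq: "P *\<^sub>v q \<in> carrier_vec n" using Pc w q by auto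
  have Sg: "H *\<^sub>v (P *\<^sub>v q) + R *\<^sub>v g = H *\<^sub>v (P *\<^sub>v w)"
    using S_mult[OF g] pos_def_inv_vec(1)[OF pos_def_innovation, of "H *\<^sub>v (P *\<^sub>v w)"] H Pw
    by (simp add: g_def q_def)
  have 1: "w \<bullet> (U *\<^sub>v w) = w \<bullet> (P *\<^sub>v w) - w \<bullet> (P *\<^sub>v q)"
    unfolding U_mult[OF w(1)] q_def g_def
    using Pw Pq w by (intro scalar_prod_minus_distrib[of _ n]) (auto simp: q_def g_def)
  have hq: "q \<bullet> (P *\<^sub>v v) = g \<bullet> (H *\<^sub>v (P *\<^sub>v v))" if "v \<in> carrier_vec n" for v
    using transpose_vec_mult_scalar[OF H, of "P *\<^sub>v v" g] that g Pc by (simp add: q_def)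
  have "g \<bullet> (H *\<^sub>v (P *\<^sub>v w)) = g \<bullet> (H *\<^sub>v (P *\<^sub>v q)) + g \<bullet> (R *\<^sub>v g)"
    unfolding Sg[symmetric] using g H Pq Rc by (intro scalar_prod_add_distrib[of _ k]) auto
  then have 2: "q \<bullet> (P *\<^sub>v w) = q \<bullet> (P *\<^sub>v q) + g \<bullet> (R *\<^sub>v g)"
    using hq[OF w(1)] hq[OF q] by simp
  have 3: "w \<bullet> (P *\<^sub>v q) = q \<bullet> (P *\<^sub>v w)"
    using scalar_prod_sym_mat[OF Pc PT w(1) q] comm_scalar_prod[of "P *\<^sub>v w" n q] Pw q by simp
  have wq: "w - q \<in> carrier_vec n" using w q by simp
  have "(w - q) \<bullet> (P *\<^sub>v (w - q)) = w \<bullet> (P *\<^sub>v w) - 2 * (q \<bullet> (P *\<^sub>v w)) + q \<bullet> (P *\<^sub>v q)"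
    using w q Pw Pq 3
    by (simp add: mult_minus_distrib_mat_vec[OF Pc] minus_scalar_prod_distrib[of _ n]
        scalar_prod_minus_distrib[of _ n])
  then have 4: "w \<bullet> (U *\<^sub>v w) = (w - q) \<bullet> (P *\<^sub>v (w - q)) + g \<bullet> (R *\<^sub>v g)"
    using 1 2 3 by simp
  show "0 < w \<bullet> (U *\<^sub>v w)"
  proof (cases "g = 0\<^sub>v k")
    case True
    then have "q = 0\<^sub>v n" using HTc by (auto simp: q_def)
    then have "w - q = w" using w by auto
    then show ?thesis using 4 pos_def_matD(3)[OF P w] pos_def_mat_nonneg[OF R g] by simp
  next
    case False
    then show ?thesis using 4 pos_def_matD(3)[OF R g] pos_def_mat_nonneg[OF P wq] by simp
  qed
qed

text \<open>Two block triangular factorisations of the joint covariance matrix of state and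
  measurement.\<close>
lemma det_kalman_update: "det S * det U = det R * det P"
proof -
  note I = pos_def_inv(1)[OF pos_def_innovation pos_def_innovation]
  let ?T = "transpose_mat H"
  let ?PT = "P * ?T" and ?HP = "H * P"
  \<comment> \<open>In \<open>?A * ?B\<close> the Schur complement of the block \<open>P\<close> is
    \<open>R\<close>, in \<open>?C * ?D\<close> that of the block \<open>S\<close> is
    \<open>U\<close>. The unit triangular factors \<open>?A\<close> and \<open>?C\<close> have
    determinant 1.\<close>
  let ?J = "four_block_mat P ?PT ?HP S"
  let ?A = "four_block_mat (1\<^sub>m n) (0\<^sub>m n k) H (1\<^sub>m k)"
  let ?B = "four_block_mat P ?PT (0\<^sub>m k n) R"
  let ?C = "four_block_mat (1\<^sub>m n) (?PT * inv_mat S) (0\<^sub>m k n) (1\<^sub>m k)"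
  let ?D = "four_block_mat U (0\<^sub>m n k) ?HP S"
  have "?A * ?B = four_block_mat (1\<^sub>m n * P + 0\<^sub>m n k * 0\<^sub>m k n) (1\<^sub>m n * ?PT + 0\<^sub>m n k * R)
      (H * P + 1\<^sub>m k * 0\<^sub>m k n) (H * ?PT + 1\<^sub>m k * R)"
    using Pc H HTc Rc by (intro mult_four_block_mat) auto
  also have "\<dots> = ?J"
    using Pc H HTc Rc assoc_mult_mat[of H k n P n ?T k] by (simp add: S_eq)
  finally have AB: "?A * ?B = ?J" .
  have "?C * ?D = four_block_mat (1\<^sub>m n * U + (?PT * inv_mat S) * ?HP) (1\<^sub>m n * 0\<^sub>m n k + (?PT * inv_mat S) * S)
      (0\<^sub>m k n * U + 1\<^sub>m k * ?HP) (0\<^sub>m k n * 0\<^sub>m n k + 1\<^sub>m k * S)"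
    using Pc H HTc Sc Uc I by (intro mult_four_block_mat) auto
  also have "\<dots> = ?J"
  proof -
    have "(?PT * inv_mat S) * S = ?PT"
      using assoc_mult_mat[OF mult_carrier_mat[OF Pc HTc] I Sc]
        pos_def_inv(3)[OF pos_def_innovation pos_def_innovation]
        right_mult_one_mat[OF mult_carrier_mat[OF Pc HTc]] by metis
    moreover have "U + (?PT * inv_mat S) * ?HP = P"
      unfolding U_eq using assoc_mult_mat[of "?PT * inv_mat S" n k H n P n] Pc H HTc I
      by (intro eq_matI) auto
    ultimately show ?thesis using Pc H HTc Sc Uc I by simp
  qed
  finally have CD: "?C * ?D = ?J" .
  have "det ?A * det ?B = det ?J"
    using det_mult[of ?A "n + k" ?B] AB Pc Rc by simp
  moreover have "det ?C * det ?D = det ?J"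
    using det_mult[of ?C "n + k" ?D] CD Uc Sc by simp
  moreover have "det ?A = 1"
    using H by (subst det_four_block_mat_upper_right_zero[where n=n and m=k]) auto
  moreover have "det ?B = det P * det R"
    using Pc HTc Rc by (subst det_four_block_mat_lower_left_zero[where n=n and m=k]) auto
  moreover have "det ?C = 1"
    using Pc HTc I by (subst det_four_block_mat_lower_left_zero[where n=n and m=k]) auto
  moreover have "det ?D = det U * det S"
    using Uc Pc H Sc by (subst det_four_block_mat_upper_right_zero[where n=n and m=k]) auto
  ultimately show ?thesis by (simp add: mult.commute)
qed

text \<open>Completing the square: with \<open>y\<close> the deviation of the state and \<open>e\<close> the innovation, put
  \<open>u = R\<^sup>-\<^sup>1 (e - H y)\<close>, \<open>v = P\<^sup>-\<^sup>1 y\<close> and \<open>t = S\<^sup>-\<^sup>1 e\<close>; then \<open>U\<close> maps \<open>v - H\<^sup>T u\<close> to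
  \<open>y - P H\<^sup>T t\<close>, so no inverse of \<open>U\<close> has to be computed.\<close>
lemma quad_form_kalman_update:
  assumes y: "y \<in> carrier_vec n" and e: "e \<in> carrier_vec k"
  defines "y' \<equiv> y - (P * transpose_mat H * inv_mat S) *\<^sub>v e"
  shows "(e - H *\<^sub>v y) \<bullet> (inv_mat R *\<^sub>v (e - H *\<^sub>v y)) + y \<bullet> (inv_mat P *\<^sub>v y)
    = e \<bullet> (inv_mat S *\<^sub>v e) + y' \<bullet> (inv_mat U *\<^sub>v y')"
proof -
  let ?T = "transpose_mat H"
  define u where "u = inv_mat R *\<^sub>v (e - H *\<^sub>v y)"
  define v where "v = inv_mat P *\<^sub>v y"
  define t where "t = inv_mat S *\<^sub>v e"
  have Hy: "H *\<^sub>v y \<in> carrier_vec k" using H y by simp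
  have u: "u \<in> carrier_vec k" using pos_def_inv(1)[OF R R] e Hy by (simp add: u_def)
  have v: "v \<in> carrier_vec n" using pos_def_inv(1)[OF P P] y by (simp add: v_def)
  have t: "t \<in> carrier_vec k"
    using pos_def_inv(1)[OF pos_def_innovation pos_def_innovation] e by (simp add: t_def)
  have Tu: "?T *\<^sub>v u \<in> carrier_vec n" and Tt: "?T *\<^sub>v t \<in> carrier_vec n" using HTc u t by auto
  have Pv: "P *\<^sub>v v = y" unfolding v_def by (rule pos_def_inv_vec[OF P y])
  have Ru: "R *\<^sub>v u = e - H *\<^sub>v y"
    unfolding u_def using e Hy by (intro pos_def_inv_vec[OF R]) auto
  have St: "S *\<^sub>v t = e" unfolding t_def by (rule pos_def_inv_vec[OF pos_def_innovation e])
  define a where "a = P *\<^sub>v (?T *\<^sub>v t)"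
  define c where "c = P *\<^sub>v (?T *\<^sub>v u)"
  have a: "a \<in> carrier_vec n" and c: "c \<in> carrier_vec n" using Pc Tt Tu by (auto simp: a_def c_def)
  have Ha: "H *\<^sub>v a + R *\<^sub>v t = e" using S_mult[OF t] St by (simp add: a_def)
  have y': "y' = y - a" using K_mult[OF e] by (simp add: y'_def a_def t_def)
  define w where "w = v - ?T *\<^sub>v u"
  have w: "w \<in> carrier_vec n" using v Tu by (simp add: w_def)
  have Hc: "H *\<^sub>v c \<in> carrier_vec k" "H *\<^sub>v a \<in> carrier_vec k" using H a c by auto
  have Pw: "P *\<^sub>v w = y - c"
    unfolding w_def c_def using mult_minus_distrib_mat_vec[OF Pc v Tu] Pv by simp
  have Su: "S *\<^sub>v u = H *\<^sub>v c + (e - H *\<^sub>v y)" using S_mult[OF u] Ru by (simp add: c_def)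
  have "H *\<^sub>v (P *\<^sub>v w) = H *\<^sub>v y - H *\<^sub>v c"
    unfolding Pw by (rule mult_minus_distrib_mat_vec[OF H y c])
  also have "\<dots> = e - S *\<^sub>v u" unfolding Su using e Hy Hc by (intro eq_vecI) auto
  also have "\<dots> = S *\<^sub>v (t - u)" using mult_minus_distrib_mat_vec[OF Sc t u] St by simp
  finally have "inv_mat S *\<^sub>v (H *\<^sub>v (P *\<^sub>v w)) = t - u"
    using pos_def_inv_vec(2)[OF pos_def_innovation, of "t - u"] t u by simp
  then have "U *\<^sub>v w = (y - c) - P *\<^sub>v (?T *\<^sub>v (t - u))" using U_mult[OF w] Pw by simp
  also have "P *\<^sub>v (?T *\<^sub>v (t - u)) = a - c"
    unfolding a_def c_def using mult_minus_distrib_mat_vec[OF HTc t u]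
      mult_minus_distrib_mat_vec[OF Pc Tt Tu] by simp
  also have "(y - c) - (a - c) = y'" unfolding y' using y c a by (intro eq_vecI) auto
  finally have "inv_mat U *\<^sub>v y' = w"
    using pos_def_inv_vec(2)[OF pos_def_kalman_update w] by simp
  then have "y' \<bullet> (inv_mat U *\<^sub>v y') = (y - a) \<bullet> (v - ?T *\<^sub>v u)" by (simp add: y' w_def)
  also have "\<dots> = y \<bullet> v - y \<bullet> (?T *\<^sub>v u) - a \<bullet> v + a \<bullet> (?T *\<^sub>v u)"
    using y a v Tu by (simp add: minus_scalar_prod_distrib[of _ n] scalar_prod_minus_distrib[of _ n])
  also have "y \<bullet> (?T *\<^sub>v u) = u \<bullet> (H *\<^sub>v y)"
    using transpose_vec_mult_scalar[OF H y u] comm_scalar_prod[OF y Tu] by simp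
  also have "a \<bullet> (?T *\<^sub>v u) = u \<bullet> (H *\<^sub>v a)"
    using transpose_vec_mult_scalar[OF H a u] comm_scalar_prod[OF a Tu] by simp
  also have "a \<bullet> v = t \<bullet> (H *\<^sub>v y)"
    using scalar_prod_sym_mat[OF Pc pos_def_matD(2)[OF P] Tt v] Pv
      transpose_vec_mult_scalar[OF H y t] by (simp add: a_def)
  finally have 1: "y' \<bullet> (inv_mat U *\<^sub>v y') = y \<bullet> v - u \<bullet> (H *\<^sub>v y) - t \<bullet> (H *\<^sub>v y) + u \<bullet> (H *\<^sub>v a)" .
  have Rtc: "R *\<^sub>v t \<in> carrier_vec k" "R *\<^sub>v u \<in> carrier_vec k" using Rc t u by auto
  \<comment> \<open>The term \<open>u \<bullet> (H a)\<close> has no counterpart in the claim. It is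
    eliminated by evaluating \<open>u \<bullet> e\<close> through \<open>e = H a + R t\<close>, the
    symmetry of \<open>R\<close>, and \<open>R u = e - H y\<close>.\<close>
  have "u \<bullet> e = u \<bullet> (H *\<^sub>v a) + u \<bullet> (R *\<^sub>v t)"
    using Ha u Hc Rtc scalar_prod_add_distrib[of u k "H *\<^sub>v a" "R *\<^sub>v t"] by simp
  also have "u \<bullet> (R *\<^sub>v t) = t \<bullet> (R *\<^sub>v u)"
    using scalar_prod_sym_mat[OF Rc pos_def_matD(2)[OF R] u t] comm_scalar_prod[OF Rtc(2) t] by simp
  also have "t \<bullet> (R *\<^sub>v u) = t \<bullet> e - t \<bullet> (H *\<^sub>v y)"
    unfolding Ru using t e Hy by (intro scalar_prod_minus_distrib[of _ k]) auto
  finally have 2: "u \<bullet> e = u \<bullet> (H *\<^sub>v a) + t \<bullet> e - t \<bullet> (H *\<^sub>v y)" by simp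
  have "(e - H *\<^sub>v y) \<bullet> u = u \<bullet> e - u \<bullet> (H *\<^sub>v y)"
    using u e Hy comm_scalar_prod[of "e - H *\<^sub>v y" k u]
    by (simp add: scalar_prod_minus_distrib[of _ k])
  then show ?thesis
    unfolding u_def[symmetric] v_def[symmetric] t_def[symmetric]
    using 1 2 comm_scalar_prod[OF e t] by simp
qed

text \<open>Bayes' rule for a single Gaussian component. Completing the square matches the exponents
  and the determinant identity matches the normalising constants. The first factor on the right is
  free of \<open>x\<close> and becomes part of the weight of the component.\<close>

lemma gauss_kalman_update:
  assumes x: "x \<in> carrier_vec n" and z: "z \<in> carrier_vec k" and m: "m \<in> carrier_vec n"
    and d: "d \<in> carrier_vec k"
  shows "gauss z (H *\<^sub>v x + d) R * gauss x m P =
    gauss z (H *\<^sub>v m + d) S *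
    gauss x (m + (P * transpose_mat H * inv_mat S) *\<^sub>v (z - (H *\<^sub>v m + d))) U"
proof -
  define y where "y = x - m"
  define e where "e = z - (H *\<^sub>v m + d)"
  let ?K = "P * transpose_mat H * inv_mat S"
  have y: "y \<in> carrier_vec n" and e: "e \<in> carrier_vec k"
    using x m z d H by (auto simp: y_def e_def)
  have Ke: "?K *\<^sub>v e \<in> carrier_vec n"
    using mult_mat_vec_carrier[OF Kc e] .
  have "H *\<^sub>v y = H *\<^sub>v x - H *\<^sub>v m"
    unfolding y_def by (rule mult_minus_distrib_mat_vec[OF H x m])
  then have 1: "z - (H *\<^sub>v x + d) = e - H *\<^sub>v y"
    unfolding e_def using z d H x m by (intro eq_vecI) auto
  have 2: "x - (m + ?K *\<^sub>v e) = y - ?K *\<^sub>v e"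
    unfolding y_def using x m Ke Pc by (intro eq_vecI) auto
  have 3: "sqrt ((2 * pi) ^ k * det R) * sqrt ((2 * pi) ^ n * det P)
      = sqrt ((2 * pi) ^ k * det S) * sqrt ((2 * pi) ^ n * det U)"
    using det_kalman_update by (simp add: real_sqrt_mult[symmetric] mult_ac)
  have exps: "exp (- A / 2) * exp (- B / 2) = exp (- C / 2) * exp (- D / 2)"
    if "A + B = C + D" for A B C D :: real
    unfolding exp_add[symmetric] using that by (simp add: field_simps)
  show ?thesis
    using x z exps[OF quad_form_kalman_update[OF y e]] 3
    by (simp add: gauss_def 1 2 e_def[symmetric] y_def[symmetric])
qed

end

section \<open>Gaussian integrals\<close>

abbreviation lborel_fun :: "nat \<Rightarrow> (nat \<Rightarrow> real) measure" where
  "lborel_fun n \<equiv> \<Pi>\<^sub>M i\<in>{..<n}. lborel"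

interpretation lborel_product: product_sigma_finite "\<lambda>_::nat. lborel :: real measure"
  by unfold_locales

lemma measurable_triangular_affine:
  fixes l :: "nat \<Rightarrow> nat \<Rightarrow> real"
  shows "(\<lambda>w. \<lambda>i\<in>{..<n}. a i + (\<Sum>j\<le>i. l i j * w j)) \<in> measurable (lborel_fun n) (lborel_fun n)"
proof (intro measurable_restrict)
  fix i assume "i \<in> {..<n}"
  then show "(\<lambda>w. a i + (\<Sum>j\<le>i. l i j * w j)) \<in> measurable (lborel_fun n) lborel"
    unfolding measurable_lborel1 by (intro borel_measurable_add borel_measurable_const
        borel_measurable_sum borel_measurable_times
        measurable_compose[OF measurable_component_singleton]) auto
qed

text \<open>Since the matrix is lower triangular, the last variable enters only the last image
  coordinate. By Tonelli it is integrated first, with the others fixed, and this is a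
  one-dimensional affine substitution with slope \<open>l n n\<close> and a shift \<open>c w\<close>
  depending on the earlier variables.\<close>

lemma nn_integral_triangular_affine:
  fixes l :: "nat \<Rightarrow> nat \<Rightarrow> real"
  assumes "\<And>i. i < n \<Longrightarrow> 0 < l i i" "g \<in> borel_measurable (lborel_fun n)"
  shows "(\<integral>\<^sup>+x. g x \<partial>lborel_fun n)
    = ennreal (\<Prod>i<n. l i i) * (\<integral>\<^sup>+w. g (\<lambda>i\<in>{..<n}. a i + (\<Sum>j\<le>i. l i j * w j)) \<partial>lborel_fun n)"
  using assms
proof (induction n arbitrary: g)
  case 0
  then show ?case by (simp add: PiM_empty nn_integral_count_space_finite restrict_def)
next
  case (Suc n)
  define T where "T m w = (\<lambda>i\<in>{..<m}. a i + (\<Sum>j\<le>i. l i j * w j))" for m :: nat and w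
  define c where "c w = a n + (\<Sum>j<n. l n j * w j)" for w
  have T[measurable]: "T m \<in> measurable (lborel_fun m) (lborel_fun m)" for m
    unfolding T_def[abs_def] by (rule measurable_triangular_affine)
  have ins: "{..<Suc n} = insert n {..<n}" by auto
  note g[measurable] = Suc.prems(2)
  have upd[measurable]: "(\<lambda>(x, y). x(n := y)) \<in> measurable (lborel_fun n \<Otimes>\<^sub>M lborel) (lborel_fun (Suc n))"
    unfolding ins by (rule measurable_add_dim)
  define G where "G x = (\<integral>\<^sup>+y. g (x(n := y)) \<partial>lborel)" for x
  have Gm: "G \<in> borel_measurable (lborel_fun n)"
    unfolding G_def[abs_def] by measurable
  have ln: "0 < l n n" using Suc.prems(1) by simp
  have T_Suc: "T (Suc n) (w(n := y)) = (T n w)(n := c w + l n n * y)" for w y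
  proof (rule ext)
    fix i
    have "(\<Sum>j\<le>n. l n j * (if j = n then y else w j)) = (\<Sum>j<n. l n j * w j) + l n n * y"
      unfolding lessThan_Suc_atMost[symmetric] by simp
    moreover have "(\<Sum>j\<le>i. l i j * (if j = n then y else w j)) = (\<Sum>j\<le>i. l i j * w j)" if "i < n"
      using that by (intro sum.cong) auto
    ultimately show "T (Suc n) (w(n := y)) i = ((T n w)(n := c w + l n n * y)) i"
      by (auto simp: T_def c_def fun_upd_def)
  qed
  have inner: "ennreal (l n n) * (\<integral>\<^sup>+y. g (T (Suc n) (w(n := y))) \<partial>lborel) = G (T n w)"
    if "w \<in> space (lborel_fun n)" for w
  proof -
    have "T n w \<in> space (lborel_fun n)" using measurable_space[OF T that] .
    then have "(\<lambda>y. g ((T n w)(n := y))) \<in> borel_measurable borel"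
      by measurable
    from nn_integral_real_affine[OF this, of "l n n" "c w"] ln
    show ?thesis by (simp add: T_Suc G_def)
  qed
  have "(\<integral>\<^sup>+x. g x \<partial>lborel_fun (Suc n)) = (\<integral>\<^sup>+x. G x \<partial>lborel_fun n)"
    using g unfolding ins G_def by (intro lborel_product.product_nn_integral_insert) auto
  also have "\<dots> = ennreal (\<Prod>i<n. l i i) * (\<integral>\<^sup>+w. G (T n w) \<partial>lborel_fun n)"
    unfolding T_def using Suc.prems(1) Gm by (intro Suc.IH) auto
  also have "(\<integral>\<^sup>+w. G (T n w) \<partial>lborel_fun n)
      = (\<integral>\<^sup>+w. ennreal (l n n) * (\<integral>\<^sup>+y. g (T (Suc n) (w(n := y))) \<partial>lborel) \<partial>lborel_fun n)"
    by (intro nn_integral_cong) (simp add: inner)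
  also have "\<dots> = ennreal (l n n) * (\<integral>\<^sup>+w. (\<integral>\<^sup>+y. g (T (Suc n) (w(n := y))) \<partial>lborel) \<partial>lborel_fun n)"
    by (intro nn_integral_cmult) measurable
  also have "(\<integral>\<^sup>+w. (\<integral>\<^sup>+y. g (T (Suc n) (w(n := y))) \<partial>lborel) \<partial>lborel_fun n)
      = (\<integral>\<^sup>+w. g (T (Suc n) w) \<partial>lborel_fun (Suc n))"
  proof -
    have "(\<lambda>w. g (T (Suc n) w)) \<in> borel_measurable (lborel_fun (Suc n))" by measurable
    then show ?thesis
      unfolding ins by (intro lborel_product.product_nn_integral_insert[symmetric]) auto
  qed
  also have "ennreal (\<Prod>i<n. l i i) * (ennreal (l n n) * (\<integral>\<^sup>+w. g (T (Suc n) w) \<partial>lborel_fun (Suc n)))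
      = ennreal (\<Prod>i<Suc n. l i i) * (\<integral>\<^sup>+w. g (T (Suc n) w) \<partial>lborel_fun (Suc n))"
  proof -
    have "0 \<le> (\<Prod>i<n. l i i)"
      using Suc.prems(1) by (intro prod_nonneg) (auto intro: less_imp_le)
    then show ?thesis using ln by (simp add: ennreal_mult mult.assoc)
  qed
  finally show ?case by (simp only: T_def)
qed

section \<open>Transfer from coordinate functions to vectors\<close>

lemma inj_on_vec: "inj_on (vec n) (space (lborel_fun n))"
proof (rule inj_onI)
  fix f g :: "nat \<Rightarrow> real"
  assume fg: "f \<in> space (lborel_fun n)" "g \<in> space (lborel_fun n)" and eq: "vec n f = vec n g"
  show "f = g"
  proof (rule ext)
    fix i show "f i = g i"
    proof (cases "i < n")
      case True
      then show ?thesis using arg_cong[OF eq, of "\<lambda>v. v $ i"] by simp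
    next
      case False
      then show ?thesis using fg by (auto simp: space_PiM PiE_def extensional_def)
    qed
  qed
qed

lemma space_lborel_vec: "space (lborel_vec n) = carrier_vec n"
proof
  show "space (lborel_vec n) \<subseteq> carrier_vec n" by (auto simp: lborel_vec_def space_embed_measure)
  show "carrier_vec n \<subseteq> space (lborel_vec n)"
  proof
    fix v :: "real vec" assume "v \<in> carrier_vec n"
    then have "v = vec n (restrict (($) v) {..<n})" by (intro eq_vecI) auto
    moreover have "restrict (($) v) {..<n} \<in> space (lborel_fun n)" by (simp add: space_PiM)
    ultimately show "v \<in> space (lborel_vec n)"
      unfolding lborel_vec_def space_embed_measure by (rule image_eqI)
  qed
qed

lemma measurable_vec: "vec n \<in> measurable (lborel_fun n) (lborel_vec n)"
  unfolding lborel_vec_def by (rule measurable_embed_measure2'[OF inj_on_vec])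

lemma measurable_lborel_vec_index[measurable]:
  "i < n \<Longrightarrow> (\<lambda>x. x $ i) \<in> borel_measurable (lborel_vec n)"
  unfolding lborel_vec_def
  by (rule measurable_embed_measure1) (simp add: measurable_component_singleton)

lemma quad_form_diff_sum:
  fixes A :: "real mat"
  assumes "A \<in> carrier_mat n n" "x \<in> carrier_vec n" "a \<in> carrier_vec n"
  shows "(x - a) \<bullet> (A *\<^sub>v (x - a)) = (\<Sum>i<n. \<Sum>j<n. A $$ (i, j) * ((x $ i - a $ i) * (x $ j - a $ j)))"
  using quad_form_sum[OF assms(1), of "x - a"] assms by simp

lemma borel_measurable_gauss[measurable]:
  assumes "pos_def_mat n P" "a \<in> carrier_vec n"
  shows "(\<lambda>x. gauss x a P) \<in> borel_measurable (lborel_vec n)"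
proof -
  \<comment> \<open>Measurability is known for the coordinates, so the exponent is first written as
    a polynomial in them.\<close>
  have "(\<lambda>x. exp (- (\<Sum>i<n. \<Sum>j<n. inv_mat P $$ (i, j) * ((x $ i - a $ i) * (x $ j - a $ j))) / 2)
      / sqrt ((2 * pi) ^ n * det P)) \<in> borel_measurable (lborel_vec n)"
    by measurable
  then show ?thesis
    by (subst measurable_cong)
      (auto simp: gauss_def space_lborel_vec quad_form_diff_sum[OF pos_def_inv(1)[OF assms(1,1)] _ assms(2)])
qed

text \<open>A Gaussian vector is \<open>a + L w\<close> with \<open>P = L L\<^sup>T\<close> and \<open>w\<close> standard normal.\<close>
lemma gaussian_change_of_variables:
  assumes P: "pos_def_mat n P" and a: "a \<in> carrier_vec n"
  obtains L where "L \<in> carrier_mat n n" "P = L * transpose_mat L" "0 < det L"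
    "\<forall>g\<in>borel_measurable (lborel_vec n). (\<integral>\<^sup>+x. g x \<partial>lborel_vec n)
      = ennreal (det L) * (\<integral>\<^sup>+w. g (a + L *\<^sub>v vec n w) \<partial>lborel_fun n)"
    "(\<lambda>w. a + L *\<^sub>v vec n w) \<in> measurable (lborel_fun n) (lborel_vec n)"
    "\<forall>w. gauss (a + L *\<^sub>v vec n w) a P * det L = (\<Prod>i<n. std_normal_density (w i))"
proof -
  from cholesky[OF P] obtain L where L: "L \<in> carrier_mat n n"
    and low: "\<And>i j. i < j \<Longrightarrow> j < n \<Longrightarrow> L $$ (i, j) = 0"
    and diag: "\<And>i. i < n \<Longrightarrow> 0 < L $$ (i, i)" and PL: "P = L * transpose_mat L" by auto
  have detL: "det L = (\<Prod>i<n. L $$ (i, i))"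
    using det_lower_triangular[OF low L] L by (simp add: prod_list_diag_prod atLeast0LessThan)
  have det_pos: "0 < det L" unfolding detL using diag by (intro prod_pos) auto
  have affine: "a + L *\<^sub>v vec n w = vec n (\<lambda>i\<in>{..<n}. a $ i + (\<Sum>j\<le>i. L $$ (i, j) * w j))" for w
  proof (rule eq_vecI)
    fix i assume "i < dim_vec (vec n (\<lambda>i\<in>{..<n}. a $ i + (\<Sum>j\<le>i. L $$ (i, j) * w j)))"
    then have i: "i < n" by simp
    have "(\<Sum>j<n. L $$ (i, j) * w j) = (\<Sum>j\<le>i. L $$ (i, j) * w j)"
      using i low by (intro sum.mono_neutral_right) auto
    then show "(a + L *\<^sub>v vec n w) $ i = vec n (\<lambda>i\<in>{..<n}. a $ i + (\<Sum>j\<le>i. L $$ (i, j) * w j)) $ i"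
      using i a L by (simp add: scalar_prod_def atLeast0LessThan)
  qed (use a L in simp)
  have int: "(\<integral>\<^sup>+x. g x \<partial>lborel_vec n) = ennreal (det L) * (\<integral>\<^sup>+w. g (a + L *\<^sub>v vec n w) \<partial>lborel_fun n)"
    if g: "g \<in> borel_measurable (lborel_vec n)" for g
  proof -
    have "(\<integral>\<^sup>+x. g x \<partial>lborel_vec n) = (\<integral>\<^sup>+x. g (vec n x) \<partial>lborel_fun n)"
      unfolding lborel_vec_def using g
      by (intro nn_integral_embed_measure' inj_on_vec) (simp add: lborel_vec_def)
    also have "\<dots> = ennreal (det L) * (\<integral>\<^sup>+w. g (a + L *\<^sub>v vec n w) \<partial>lborel_fun n)"
      unfolding affine detL using diag measurable_compose[OF measurable_vec g]
      by (intro nn_integral_triangular_affine) auto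
    finally show ?thesis .
  qed
  have meas: "(\<lambda>w. a + L *\<^sub>v vec n w) \<in> measurable (lborel_fun n) (lborel_vec n)"
    unfolding affine by (rule measurable_compose[OF measurable_triangular_affine measurable_vec])
  have dens: "gauss (a + L *\<^sub>v vec n w) a P * det L = (\<Prod>i<n. std_normal_density (w i))" for w
  proof -
    let ?w = "vec n w"
    have w: "?w \<in> carrier_vec n" by simp
    have Lw: "L *\<^sub>v ?w \<in> carrier_vec n" using L by simp
    have LT: "det (transpose_mat L) \<noteq> 0" "transpose_mat L \<in> carrier_mat n n"
      using det_transpose[OF L] det_pos L by auto
    note I = inv_mat_inverse[OF LT(2,1)]
    \<comment> \<open>With \<open>L^T u = w\<close> one gets \<open>P u = L w\<close>, so
      \<open>u\<close> is the inverse of \<open>P\<close> applied to \<open>L w\<close>, and the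
      exponent collapses to \<open>w \<bullet> w\<close>.\<close>
    define u where "u = inv_mat (transpose_mat L) *\<^sub>v ?w"
    have u: "u \<in> carrier_vec n" using I by (simp add: u_def)
    have LTu: "transpose_mat L *\<^sub>v u = ?w"
      unfolding u_def using I LT w by (metis assoc_mult_mat_vec one_mult_mat_vec)
    have Pu: "P *\<^sub>v u = L *\<^sub>v ?w"
      unfolding PL using LTu L LT u by (metis assoc_mult_mat_vec)
    have diff: "a + L *\<^sub>v ?w - a = L *\<^sub>v ?w" using a L by (intro eq_vecI) auto
    have "(L *\<^sub>v ?w) \<bullet> (inv_mat P *\<^sub>v (L *\<^sub>v ?w)) = (L *\<^sub>v ?w) \<bullet> u"
      using pos_def_inv_vec(2)[OF P u] Pu by simp
    also have "\<dots> = ?w \<bullet> ?w"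
      using transpose_vec_mult_scalar[OF L w u] LTu comm_scalar_prod[OF Lw u] by simp
    also have "\<dots> = (\<Sum>i<n. (w i)\<^sup>2)" by (simp add: scalar_prod_def atLeast0LessThan power2_eq_square)
    finally have q: "(L *\<^sub>v ?w) \<bullet> (inv_mat P *\<^sub>v (L *\<^sub>v ?w)) = (\<Sum>i<n. (w i)\<^sup>2)" .
    have "det P = det L * det L" unfolding PL using det_mult[OF L LT(2)] det_transpose[OF L] by simp
    then have "sqrt ((2 * pi) ^ n * det P) = sqrt (2 * pi) ^ n * det L"
      using det_pos by (simp add: real_sqrt_mult real_sqrt_power power_mult_distrib)
    then have "gauss (a + L *\<^sub>v ?w) a P * det L = exp (- (\<Sum>i<n. (w i)\<^sup>2) / 2) / sqrt (2 * pi) ^ n"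
      using det_pos a L by (simp add: gauss_def diff q)
    also have "\<dots> = (\<Prod>i<n. std_normal_density (w i))"
      by (simp add: std_normal_density_def prod_dividef exp_sum[symmetric] sum_negf sum_divide_distrib)
    finally show ?thesis .
  qed
  from that[OF L PL det_pos] int meas dens show ?thesis by blast
qed

text \<open>Applied to indicators, the substitution formula says that Lebesgue measure is the image
  measure under \<open>w \<mapsto> a + L w\<close> scaled by \<open>det L\<close>. This carries
  signed integrals over at once, without splitting them into positive and negative parts. The factor
  \<open>L\<close> appears in the conclusion because the moments are computed from its
  entries.\<close>

lemma has_bochner_integral_gauss:
  assumes P: "pos_def_mat n P" and a: "a \<in> carrier_vec n"
  obtains L where "L \<in> carrier_mat n n" "P = L * transpose_mat L"
    "\<forall>h\<in>borel_measurable (lborel_vec n). \<forall>c. has_bochner_integral (lborel_fun n)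
        (\<lambda>w. (\<Prod>i<n. std_normal_density (w i)) * h (a + L *\<^sub>v vec n w)) c \<longrightarrow>
      has_bochner_integral (lborel_vec n) (\<lambda>x. gauss x a P * h x) (c :: real)"
proof -
  obtain L where L: "L \<in> carrier_mat n n"
      "P = L * transpose_mat L" and det: "0 < det L"
    and int: "\<forall>g\<in>borel_measurable (lborel_vec n). (\<integral>\<^sup>+x. g x \<partial>lborel_vec n)
      = ennreal (det L) * (\<integral>\<^sup>+w. g (a + L *\<^sub>v vec n w) \<partial>lborel_fun n)"
    and meas[measurable]: "(\<lambda>w. a + L *\<^sub>v vec n w) \<in> measurable (lborel_fun n) (lborel_vec n)"
    and dens: "\<forall>w. gauss (a + L *\<^sub>v vec n w) a P * det L = (\<Prod>i<n. std_normal_density (w i))"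
    by (rule gaussian_change_of_variables[OF P a])
  let ?M = "distr (lborel_fun n) (lborel_vec n) (\<lambda>w. a + L *\<^sub>v vec n w)"
  have eq: "lborel_vec n = density ?M (\<lambda>_. ennreal (det L))"
  proof (rule measure_eqI)
    fix A assume A[measurable]: "A \<in> sets (lborel_vec n)"
    have "emeasure (lborel_vec n) A = (\<integral>\<^sup>+x. indicator A x \<partial>lborel_vec n)" by simp
    also have "\<dots> = ennreal (det L) * (\<integral>\<^sup>+w. indicator A (a + L *\<^sub>v vec n w) \<partial>lborel_fun n)"
      by (intro int[THEN bspec]) measurable
    also have "(\<integral>\<^sup>+w. indicator A (a + L *\<^sub>v vec n w) \<partial>lborel_fun n) = (\<integral>\<^sup>+x. indicator A x \<partial>?M)"
      by (intro nn_integral_distr[symmetric]) measurable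
    also have "ennreal (det L) * \<dots> = emeasure (density ?M (\<lambda>_. ennreal (det L))) A"
      by (simp add: emeasure_density nn_integral_cmult)
    finally show "emeasure (lborel_vec n) A = emeasure (density ?M (\<lambda>_. ennreal (det L))) A" .
  qed simp
  have "has_bochner_integral (lborel_vec n) (\<lambda>x. gauss x a P * h x) c"
    if h[measurable]: "h \<in> borel_measurable (lborel_vec n)"
      and hb: "has_bochner_integral (lborel_fun n)
        (\<lambda>w. (\<Prod>i<n. std_normal_density (w i)) * h (a + L *\<^sub>v vec n w)) c" for h c
  proof -
    note [measurable] = borel_measurable_gauss[OF P a]
    have "has_bochner_integral (lborel_fun n)
        (\<lambda>w. det L *\<^sub>R (gauss (a + L *\<^sub>v vec n w) a P * h (a + L *\<^sub>v vec n w))) c"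
      using hb unfolding dens[rule_format, symmetric] by (simp add: mult_ac)
    then have "has_bochner_integral ?M (\<lambda>x. det L *\<^sub>R (gauss x a P * h x)) c"
      by (intro has_bochner_integral_distr) auto
    then have "has_bochner_integral (density ?M (\<lambda>_. ennreal (det L))) (\<lambda>x. gauss x a P * h x) c"
      using det by (intro has_bochner_integral_density) auto
    then show ?thesis by (simp add: eq[symmetric])
  qed
  with that[OF L] show ?thesis by blast
qed

section \<open>Moments of Gaussian densities\<close>

lemma has_bochner_integral_product_std_normal:
  fixes f :: "nat \<Rightarrow> real \<Rightarrow> real"
  assumes "\<And>k. k < n \<Longrightarrow> has_bochner_integral lborel (\<lambda>t. std_normal_density t * f k t) (c k)"
  shows "has_bochner_integral (lborel_fun n)
    (\<lambda>w. (\<Prod>k<n. std_normal_density (w k)) * (\<Prod>k<n. f k (w k))) (\<Prod>k<n. c k)"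
proof -
  have i: "integrable lborel (\<lambda>t. std_normal_density t * f k t)"
    "(\<integral>t. std_normal_density t * f k t \<partial>lborel) = c k" if "k < n" for k
    using assms[OF that] by (auto simp: has_bochner_integral_iff)
  have "has_bochner_integral (lborel_fun n) (\<lambda>w. \<Prod>k<n. std_normal_density (w k) * f k (w k)) (\<Prod>k<n. c k)"
    unfolding has_bochner_integral_iff
    using i lborel_product.product_integrable_prod[of "{..<n}" "\<lambda>k t. std_normal_density t * f k t"]
      lborel_product.product_integral_prod[of "{..<n}" "\<lambda>k t. std_normal_density t * f k t"]
    by auto
  then show ?thesis by (simp add: prod.distrib)
qed

lemma std_normal_moments:
  "has_bochner_integral lborel (\<lambda>t. std_normal_density t * 1) 1"
  "has_bochner_integral lborel (\<lambda>t. std_normal_density t * t) 0"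
  "has_bochner_integral lborel (\<lambda>t. std_normal_density t * (t * t)) 1"
  using std_normal_moment_even[of 0] std_normal_moment_odd[of 0] std_normal_moment_even[of 1]
  by (simp_all add: power2_eq_square)

lemma product_std_normal_moments:
  shows "has_bochner_integral (lborel_fun n) (\<lambda>w. \<Prod>k<n. std_normal_density (w k)) 1"
    and "i < n \<Longrightarrow> has_bochner_integral (lborel_fun n)
      (\<lambda>w. (\<Prod>k<n. std_normal_density (w k)) * w i) 0"
    and "i < n \<Longrightarrow> j < n \<Longrightarrow> has_bochner_integral (lborel_fun n)
      (\<lambda>w. (\<Prod>k<n. std_normal_density (w k)) * (w i * w j)) (if i = j then 1 else 0)"
proof -
  show "has_bochner_integral (lborel_fun n) (\<lambda>w. \<Prod>k<n. std_normal_density (w k)) 1"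
    using has_bochner_integral_product_std_normal[of n "\<lambda>_ _. 1" "\<lambda>_. 1"] std_normal_moments(1) by simp
next
  assume i: "i < n"
  let ?f = "\<lambda>k t. if k = i then t else (1::real)"
  have "has_bochner_integral (lborel_fun n)
    (\<lambda>w. (\<Prod>k<n. std_normal_density (w k)) * (\<Prod>k<n. ?f k (w k))) (\<Prod>k<n. if k = i then 0 else 1)"
    using std_normal_moments by (intro has_bochner_integral_product_std_normal) auto
  then show "has_bochner_integral (lborel_fun n) (\<lambda>w. (\<Prod>k<n. std_normal_density (w k)) * w i) 0"
    using i by simp
next
  assume ij: "i < n" "j < n"
  \<comment> \<open>One factor per coordinate makes the monomial a product to which independence
    applies. For \<open>i = j\<close> the factor at \<open>k = i\<close> is \<open>t * t\<close>, so
    the variance is covered as well.\<close>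
  let ?f = "\<lambda>k t. (if k = i then t else (1::real)) * (if k = j then t else 1)"
  have "has_bochner_integral (lborel_fun n)
    (\<lambda>w. (\<Prod>k<n. std_normal_density (w k)) * (\<Prod>k<n. ?f k (w k)))
    (\<Prod>k<n. if k = i then if i = j then 1 else 0 else if k = j then 0 else 1)"
    using std_normal_moments by (intro has_bochner_integral_product_std_normal) auto
  moreover have "(\<Prod>k<n. ?f k (w k)) = w i * w j" for w
    using ij by (simp add: prod.distrib)
  moreover have "(\<Prod>k<n. if k = i then if i = j then 1 else 0 else if k = j then 0 else 1 :: real)
      = (if i = j then 1 else 0)"
    using ij by (cases "i = j") (auto intro!: prod_zero prod.neutral)
  ultimately show "has_bochner_integral (lborel_fun n)
      (\<lambda>w. (\<Prod>k<n. std_normal_density (w k)) * (w i * w j)) (if i = j then 1 else 0)"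
    by simp
qed

text \<open>The second moments are taken about an arbitrary point \<open>b\<close> because the log
  ratio of two Gaussian densities contains quadratic forms about two different centres. After the
  substitution only the constant term and the diagonal terms \<open>k = l\<close> survive, and the
  latter add up to the entry of \<open>L L^T\<close>.\<close>

lemma gauss_moments:
  assumes P: "pos_def_mat n P" and a: "a \<in> carrier_vec n"
  shows has_bochner_integral_gauss_1: "has_bochner_integral (lborel_vec n) (\<lambda>x. gauss x a P) 1"
    and has_bochner_integral_gauss_second: "i < n \<Longrightarrow> j < n \<Longrightarrow>
      has_bochner_integral (lborel_vec n) (\<lambda>x. gauss x a P * ((x $ i - b $ i) * (x $ j - b $ j)))
        (P $$ (i, j) + (a $ i - b $ i) * (a $ j - b $ j))"
proof -
  obtain L where L: "L \<in> carrier_mat n n"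
    and PL: "P = L * transpose_mat L"
    and int: "\<forall>h\<in>borel_measurable (lborel_vec n). \<forall>c. has_bochner_integral (lborel_fun n)
        (\<lambda>w. (\<Prod>i<n. std_normal_density (w i)) * h (a + L *\<^sub>v vec n w)) c \<longrightarrow>
      has_bochner_integral (lborel_vec n) (\<lambda>x. gauss x a P * h x) (c :: real)"
    by (rule has_bochner_integral_gauss[OF P a])
  show "has_bochner_integral (lborel_vec n) (\<lambda>x. gauss x a P) 1"
    using int[rule_format, of "\<lambda>_. 1" 1] product_std_normal_moments(1) by simp
  assume i: "i < n" and j: "j < n"
  define \<Phi> where "\<Phi> w = (\<Prod>k<n. std_normal_density (w k))" for w :: "nat \<Rightarrow> real"
  define \<alpha> \<beta> where "\<alpha> = a $ i - b $ i" and "\<beta> = a $ j - b $ j"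
  have expand: "\<Phi> w * (((a + L *\<^sub>v vec n w) $ i - b $ i) * ((a + L *\<^sub>v vec n w) $ j - b $ j))
    = \<alpha> * \<beta> * \<Phi> w + (\<Sum>k<n. (\<alpha> * L $$ (j, k) + \<beta> * L $$ (i, k)) * (\<Phi> w * w k))
      + (\<Sum>k<n. \<Sum>l<n. (L $$ (i, k) * L $$ (j, l)) * (\<Phi> w * (w k * w l)))" for w
  proof -
    have comp: "(a + L *\<^sub>v vec n w) $ i = a $ i + (\<Sum>k<n. L $$ (i, k) * w k)" if "i < n" for i
      using that a L by (simp add: scalar_prod_def atLeast0LessThan)
    have "(\<Sum>k<n. \<Sum>l<n. (L $$ (i, k) * L $$ (j, l)) * (\<Phi> w * (w k * w l)))
      = \<Phi> w * ((\<Sum>k<n. L $$ (i, k) * w k) * (\<Sum>l<n. L $$ (j, l) * w l))"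
      unfolding sum_product by (simp add: sum_distrib_left mult_ac)
    moreover have "(\<Sum>k<n. (\<alpha> * L $$ (j, k) + \<beta> * L $$ (i, k)) * (\<Phi> w * w k))
      = \<Phi> w * (\<alpha> * (\<Sum>k<n. L $$ (j, k) * w k) + \<beta> * (\<Sum>k<n. L $$ (i, k) * w k))"
      by (simp add: sum_distrib_left algebra_simps sum.distrib)
    ultimately show ?thesis
      unfolding comp[OF i] comp[OF j] by (simp add: \<alpha>_def \<beta>_def algebra_simps)
  qed
  have "has_bochner_integral (lborel_fun n) (\<lambda>w. \<alpha> * \<beta> * \<Phi> w
      + (\<Sum>k<n. (\<alpha> * L $$ (j, k) + \<beta> * L $$ (i, k)) * (\<Phi> w * w k))
      + (\<Sum>k<n. \<Sum>l<n. (L $$ (i, k) * L $$ (j, l)) * (\<Phi> w * (w k * w l))))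
    (\<alpha> * \<beta> * 1 + (\<Sum>k<n. (\<alpha> * L $$ (j, k) + \<beta> * L $$ (i, k)) * 0)
      + (\<Sum>k<n. \<Sum>l<n. (L $$ (i, k) * L $$ (j, l)) * (if k = l then 1 else 0)))"
    unfolding \<Phi>_def
    by (intro has_bochner_integral_add has_bochner_integral_sum has_bochner_integral_mult_right
        product_std_normal_moments) auto
  moreover have "(\<Sum>k<n. L $$ (i, k) * L $$ (j, k)) = P $$ (i, j)"
    using i j L by (simp add: PL scalar_prod_def atLeast0LessThan)
  ultimately have "has_bochner_integral (lborel_fun n)
      (\<lambda>w. \<Phi> w * (((a + L *\<^sub>v vec n w) $ i - b $ i) * ((a + L *\<^sub>v vec n w) $ j - b $ j)))
      (P $$ (i, j) + \<alpha> * \<beta>)"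
    unfolding expand by (simp add: if_distrib[of "\<lambda>x. _ * x"] add.commute[of "\<alpha> * \<beta>" "P $$ (i, j)"] cong: if_cong)
  then show "has_bochner_integral (lborel_vec n) (\<lambda>x. gauss x a P * ((x $ i - b $ i) * (x $ j - b $ j)))
        (P $$ (i, j) + (a $ i - b $ i) * (a $ j - b $ j))"
    unfolding \<Phi>_def \<alpha>_def \<beta>_def using i j by (intro int[rule_format]) measurable
qed

text \<open>The value is left as a sum over entries to show that it depends on the Gaussian only
  through its mean and covariance.\<close>

lemma has_bochner_integral_gauss_quad_form:
  assumes P: "pos_def_mat n P" and a: "a \<in> carrier_vec n" and b: "b \<in> carrier_vec n"
    and A: "A \<in> carrier_mat n n"
  shows "has_bochner_integral (lborel_vec n) (\<lambda>x. gauss x a P * ((x - b) \<bullet> (A *\<^sub>v (x - b))))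
    (\<Sum>i<n. \<Sum>j<n. A $$ (i, j) * (P $$ (i, j) + (a $ i - b $ i) * (a $ j - b $ j)))"
proof -
  have "has_bochner_integral (lborel_vec n)
      (\<lambda>x. \<Sum>i<n. \<Sum>j<n. A $$ (i, j) * (gauss x a P * ((x $ i - b $ i) * (x $ j - b $ j))))
      (\<Sum>i<n. \<Sum>j<n. A $$ (i, j) * (P $$ (i, j) + (a $ i - b $ i) * (a $ j - b $ j)))"
    by (intro has_bochner_integral_sum has_bochner_integral_mult_right
        has_bochner_integral_gauss_second[OF P a]) auto
  then show ?thesis
    by (rule has_bochner_integral_cong[THEN iffD1, rotated -1])
      (auto simp: space_lborel_vec quad_form_diff_sum[OF A _ b] sum_distrib_left mult_ac)
qed

section \<open>Kullback-Leibler divergence on the hybrid state space\<close>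

lemma state_densityD:
  assumes "state_density m n q"
  shows "\<And>r. r \<in> {1..m} \<Longrightarrow> q r \<in> borel_measurable (lborel_vec (n r))"
    and "\<And>r x. r \<in> {1..m} \<Longrightarrow> x \<in> carrier_vec (n r) \<Longrightarrow> 0 \<le> q r x"
    and "\<And>r. r \<in> {1..m} \<Longrightarrow> integrable (lborel_vec (n r)) (q r)"
    and "(\<Sum>r=1..m. \<integral>x. q r x \<partial>lborel_vec (n r)) = 1"
proof -
  show meas: "\<And>r. r \<in> {1..m} \<Longrightarrow> q r \<in> borel_measurable (lborel_vec (n r))"
    and nonneg: "\<And>r x. r \<in> {1..m} \<Longrightarrow> x \<in> carrier_vec (n r) \<Longrightarrow> 0 \<le> q r x"
    using assms by (auto simp: state_density_def)
  have sum1: "(\<Sum>r=1..m. \<integral>\<^sup>+x. ennreal (q r x) \<partial>lborel_vec (n r)) = 1"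
    using assms by (simp add: state_density_def nn_integral_states_def)
  have AE: "AE x in lborel_vec (n r). 0 \<le> q r x" if "r \<in> {1..m}" for r
    using nonneg[OF that] by (intro AE_I2) (simp add: space_lborel_vec)
  show int: "\<And>r. r \<in> {1..m} \<Longrightarrow> integrable (lborel_vec (n r)) (q r)"
  proof (rule integrableI_nonneg[OF meas AE])
    fix r assume r: "r \<in> {1..m}"
    have "(\<integral>\<^sup>+x. ennreal (q r x) \<partial>lborel_vec (n r)) \<le> 1"
      unfolding sum1[symmetric] using r by (intro member_le_sum) auto
    then show "(\<integral>\<^sup>+x. ennreal (q r x) \<partial>lborel_vec (n r)) < \<infinity>"
      by (rule le_less_trans) simp
  qed
  have "ennreal (\<Sum>r=1..m. \<integral>x. q r x \<partial>lborel_vec (n r))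
      = (\<Sum>r=1..m. ennreal (\<integral>x. q r x \<partial>lborel_vec (n r)))"
    using AE by (intro sum_ennreal[symmetric] integral_nonneg_AE) auto
  also have "\<dots> = (\<Sum>r=1..m. \<integral>\<^sup>+x. ennreal (q r x) \<partial>lborel_vec (n r))"
    using int AE by (intro sum.cong nn_integral_eq_integral[symmetric]) auto
  finally show "(\<Sum>r=1..m. \<integral>x. q r x \<partial>lborel_vec (n r)) = 1" using sum1 by simp
qed

lemma state_densityI:
  assumes "\<And>r. r \<in> {1..m} \<Longrightarrow> has_bochner_integral (lborel_vec (n r)) (q r) (c r)"
    and nonneg: "\<And>r x. r \<in> {1..m} \<Longrightarrow> x \<in> carrier_vec (n r) \<Longrightarrow> 0 \<le> q r x"
    and "(\<Sum>r=1..m. c r) = 1"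
  shows "state_density m n q"
proof -
  have int: "integrable (lborel_vec (n r)) (q r)" "(\<integral>x. q r x \<partial>lborel_vec (n r)) = c r"
    if "r \<in> {1..m}" for r
    using assms(1)[OF that] by (auto simp: has_bochner_integral_iff)
  have AE: "AE x in lborel_vec (n r). 0 \<le> q r x" if "r \<in> {1..m}" for r
    using nonneg[OF that] by (intro AE_I2) (simp add: space_lborel_vec)
  have c: "0 \<le> c r" if "r \<in> {1..m}" for r
    unfolding int(2)[OF that, symmetric] by (rule integral_nonneg_AE[OF AE[OF that]])
  have "nn_integral_states m n (\<lambda>r x. ennreal (q r x)) = (\<Sum>r=1..m. ennreal (c r))"
    unfolding nn_integral_states_def using int AE
    by (intro sum.cong) (auto simp: nn_integral_eq_integral)
  also have "\<dots> = 1" using c assms(3) by (subst sum_ennreal) auto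
  finally show ?thesis using int nonneg by (auto simp: state_density_def)
qed

text \<open>The positive and negative parts have finite integrals in every mode, so the difference
  of sums in \<open>KL_states\<close> is a sum of ordinary integrals.\<close>

lemma KL_states_eq_integral:
  assumes "\<And>r x. r \<in> {1..m} \<Longrightarrow> x \<in> carrier_vec (n r) \<Longrightarrow> kl_integrand (p r x) (q r x) = ereal (f r x)"
    and int: "\<And>r. r \<in> {1..m} \<Longrightarrow> integrable (lborel_vec (n r)) (f r)"
  shows "KL_states m n p q = ereal (\<Sum>r=1..m. \<integral>x. f r x \<partial>lborel_vec (n r))"
proof -
  let ?p = "\<lambda>r. \<integral>\<^sup>+x. ennreal (f r x) \<partial>lborel_vec (n r)"
  let ?n = "\<lambda>r. \<integral>\<^sup>+x. ennreal (- f r x) \<partial>lborel_vec (n r)"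
  have fin: "?p r \<noteq> \<infinity>" "?n r \<noteq> \<infinity>" if "r \<in> {1..m}" for r
    using int[OF that] by (auto simp: real_integrable_def)
  have "nn_integral_states m n (\<lambda>r x. e2ennreal (kl_integrand (p r x) (q r x))) = (\<Sum>r=1..m. ?p r)"
    unfolding nn_integral_states_def using assms(1)
    by (intro sum.cong nn_integral_cong) (auto simp: space_lborel_vec)
  also have "\<dots> = ennreal (\<Sum>r=1..m. enn2real (?p r))"
    using fin by (subst sum_ennreal[symmetric]) (auto intro!: sum.cong simp: less_top)
  finally have 1: "nn_integral_states m n (\<lambda>r x. e2ennreal (kl_integrand (p r x) (q r x)))
    = ennreal (\<Sum>r=1..m. enn2real (?p r))" .
  have "nn_integral_states m n (\<lambda>r x. e2ennreal (- kl_integrand (p r x) (q r x))) = (\<Sum>r=1..m. ?n r)"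
    unfolding nn_integral_states_def using assms(1)
    by (intro sum.cong nn_integral_cong) (auto simp: space_lborel_vec)
  also have "\<dots> = ennreal (\<Sum>r=1..m. enn2real (?n r))"
    using fin by (subst sum_ennreal[symmetric]) (auto intro!: sum.cong simp: less_top)
  finally have 2: "nn_integral_states m n (\<lambda>r x. e2ennreal (- kl_integrand (p r x) (q r x)))
    = ennreal (\<Sum>r=1..m. enn2real (?n r))" .
  have "(\<Sum>r=1..m. \<integral>x. f r x \<partial>lborel_vec (n r)) = (\<Sum>r=1..m. enn2real (?p r)) - (\<Sum>r=1..m. enn2real (?n r))"
    unfolding sum_subtractf[symmetric] using int
    by (intro sum.cong) (auto simp: real_lebesgue_integral_def)
  then show ?thesis
    by (simp add: KL_states_def 1 2 enn2ereal_ennreal sum_nonneg)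
qed

text \<open>In \<open>ereal\<close> infinity minus infinity is infinity, so an infinite positive
  part in one mode decides the value whatever the negative part is.\<close>

lemma KL_states_eq_top:
  assumes r: "r \<in> {1..m}"
    and top: "(\<integral>\<^sup>+x. e2ennreal (kl_integrand (p r x) (q r x)) \<partial>lborel_vec (n r)) = \<infinity>"
  shows "KL_states m n p q = \<infinity>"
proof -
  let ?f = "\<lambda>r. \<integral>\<^sup>+x. e2ennreal (kl_integrand (p r x) (q r x)) \<partial>lborel_vec (n r)"
  have "\<infinity> \<le> (\<Sum>r=1..m. ?f r)" using r top member_le_sum[of r "{1..m}" ?f] by simp
  then have "(\<Sum>r=1..m. ?f r) = \<infinity>" by (simp add: top_unique)
  then show ?thesis unfolding KL_states_def nn_integral_states_def by (simp only:) simp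
qed

text \<open>Disposes of competitors without mass in a mode that the posterior charges: the integrand
  is infinite on a whole fibre of nonzero measure.\<close>

lemma KL_states_eq_top_of_null_mode:
  assumes r: "r \<in> {1..m}" and "emeasure (lborel_vec (n r)) (carrier_vec (n r)) \<noteq> 0"
    and "\<And>x. x \<in> carrier_vec (n r) \<Longrightarrow> p r x \<noteq> 0 \<and> q r x = 0"
  shows "KL_states m n p q = \<infinity>"
proof -
  have "(\<integral>\<^sup>+x. e2ennreal (kl_integrand (p r x) (q r x)) \<partial>lborel_vec (n r))
      = (\<integral>\<^sup>+x. \<infinity> \<partial>lborel_vec (n r))"
    using assms(3) by (intro nn_integral_cong) (simp add: space_lborel_vec kl_integrand_def)
  also have "\<dots> = \<infinity>" using assms(2) by (simp add: space_lborel_vec ennreal_top_mult)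
  finally show ?thesis by (rule KL_states_eq_top[OF r])
qed

text \<open>If \<open>q\<close> has the same cross-entropy moments as \<open>p\<close> with respect to \<open>y\<close>, then
  \<open>D(p\<parallel>y) = D(p\<parallel>q) + D(q\<parallel>y)\<close>, and the last term is nonnegative by Gibbs' inequality.
  Integrability of \<open>p ln (p / q)\<close> is not assumed: it follows whenever \<open>D(p\<parallel>y)\<close> is finite.\<close>
lemma KL_states_le_of_matching:
  assumes p: "state_density m n p" and q: "state_density m n q" and y: "state_density m n y"
    and supp: "\<And>r x. r \<in> {1..m} \<Longrightarrow> x \<in> carrier_vec (n r) \<Longrightarrow>
      (p r x = 0 \<longleftrightarrow> q r x = 0) \<and> (y r x = 0 \<longrightarrow> p r x = 0)"
    and pint: "\<And>r. r \<in> {1..m} \<Longrightarrow>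
      has_bochner_integral (lborel_vec (n r)) (\<lambda>x. p r x * ln (q r x / y r x)) (c r)"
    and qint: "\<And>r. r \<in> {1..m} \<Longrightarrow>
      has_bochner_integral (lborel_vec (n r)) (\<lambda>x. q r x * ln (q r x / y r x)) (c r)"
  shows "KL_states m n p q \<le> KL_states m n p y"
proof -
  define g where "g r x = p r x * ln (p r x / y r x)" for r x
  define h where "h r x = p r x * ln (p r x / q r x)" for r x
  note pD = state_densityD[OF p] and qD = state_densityD[OF q] and yD = state_densityD[OF y]
  have pos: "0 < p r x \<and> 0 < q r x \<and> 0 < y r x \<or> p r x = 0 \<and> q r x = 0 \<and> 0 \<le> y r x"
    if "r \<in> {1..m}" "x \<in> carrier_vec (n r)" for r x
    using supp[OF that] pD(2)[OF that] qD(2)[OF that] yD(2)[OF that] by (auto simp: less_le)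
  \<comment> \<open>Used twice: integrated, for \<open>q\<close> against \<open>y\<close>, to bound
    \<open>c r\<close> from below; and pointwise, for \<open>p\<close> against \<open>y\<close>, to
    bound the negative part of \<open>g\<close>.\<close>
  have gibbs: "b - a \<le> b * ln (b / a)" if "0 < a" "0 < b" for a b :: real
  proof -
    have "ln (a / b) \<le> a / b - 1" using that by (intro ln_le_minus_one) simp
    then have "b * (- ln (a / b)) \<ge> b * (1 - a / b)" using that by (intro mult_left_mono) auto
    then show ?thesis using that by (simp add: ln_div right_diff_distrib)
  qed
  have c_ge: "(\<integral>x. q r x \<partial>lborel_vec (n r)) - (\<integral>x. y r x \<partial>lborel_vec (n r)) \<le> c r"
    if r: "r \<in> {1..m}" for r
  proof -
    have "(\<integral>x. q r x \<partial>lborel_vec (n r)) - (\<integral>x. y r x \<partial>lborel_vec (n r))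
        = (\<integral>x. q r x - y r x \<partial>lborel_vec (n r))"
      using qD(3)[OF r] yD(3)[OF r] by simp
    also have "\<dots> \<le> (\<integral>x. q r x * ln (q r x / y r x) \<partial>lborel_vec (n r))"
      using qD(3)[OF r] yD(3)[OF r] qint[OF r] pos[OF r] gibbs
      by (intro integral_mono) (fastforce simp: has_bochner_integral_iff space_lborel_vec)+
    also have "\<dots> = c r" using qint[OF r] by (simp add: has_bochner_integral_iff)
    finally show ?thesis .
  qed
  \<comment> \<open>A single \<open>c r\<close> may be negative, because \<open>q\<close> and
    \<open>y\<close> may weight the modes differently; only in the sum over all modes do the two
    total masses cancel.\<close>
  have c_nonneg: "0 \<le> (\<Sum>r=1..m. c r)"
    using sum_mono[OF c_ge, of "{1..m}" "\<lambda>r. r"] qD(4) yD(4) by (simp add: sum_subtractf)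
  have klg: "kl_integrand (p r x) (y r x) = ereal (g r x)"
    and klh: "kl_integrand (p r x) (q r x) = ereal (h r x)"
    and gh: "h r x = g r x - p r x * ln (q r x / y r x)" and gy: "- g r x \<le> y r x"
    if "r \<in> {1..m}" "x \<in> carrier_vec (n r)" for r x
    using pos[OF that] gibbs[of "y r x" "p r x"]
    by (auto simp: kl_integrand_def g_def h_def ln_div algebra_simps)
  have gm: "g r \<in> borel_measurable (lborel_vec (n r))" if "r \<in> {1..m}" for r
  proof -
    note [measurable] = pD(1)[OF that] yD(1)[OF that]
    show ?thesis unfolding g_def[abs_def] by measurable
  qed
  \<comment> \<open>Hence \<open>g r\<close> is integrable unless its positive part has infinite
    integral, and in that case the competitor's divergence is infinite.\<close>
  have neg_fin: "(\<integral>\<^sup>+x. ennreal (- g r x) \<partial>lborel_vec (n r)) \<noteq> \<infinity>" if r: "r \<in> {1..m}" for r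
  proof -
    have "(\<integral>\<^sup>+x. ennreal (- g r x) \<partial>lborel_vec (n r)) \<le> (\<integral>\<^sup>+x. ennreal (y r x) \<partial>lborel_vec (n r))"
      using gy[OF r] by (intro nn_integral_mono ennreal_leI) (simp add: space_lborel_vec)
    then show ?thesis using yD(3)[OF r] by (auto simp: real_integrable_def top_unique)
  qed
  show ?thesis
  proof (cases "\<forall>r\<in>{1..m}. (\<integral>\<^sup>+x. ennreal (g r x) \<partial>lborel_vec (n r)) \<noteq> \<infinity>")
    case True
    then have gi: "integrable (lborel_vec (n r)) (g r)" if "r \<in> {1..m}" for r
      using gm neg_fin that by (auto simp: real_integrable_def)
    have hi: "has_bochner_integral (lborel_vec (n r)) (h r) ((\<integral>x. g r x \<partial>lborel_vec (n r)) - c r)"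
      if r: "r \<in> {1..m}" for r
    proof -
      have "has_bochner_integral (lborel_vec (n r)) (\<lambda>x. g r x - p r x * ln (q r x / y r x))
          ((\<integral>x. g r x \<partial>lborel_vec (n r)) - c r)"
        using gi[OF r] by (intro has_bochner_integral_diff pint[OF r]) (simp add: has_bochner_integral_integrable)
      then show ?thesis
        by (rule has_bochner_integral_cong[THEN iffD1, rotated -1])
          (auto simp: space_lborel_vec gh[OF r])
    qed
    have "KL_states m n p q = ereal (\<Sum>r=1..m. \<integral>x. h r x \<partial>lborel_vec (n r))"
      using hi by (intro KL_states_eq_integral klh) (auto simp: has_bochner_integral_iff)
    also have "(\<Sum>r=1..m. \<integral>x. h r x \<partial>lborel_vec (n r))
        = (\<Sum>r=1..m. (\<integral>x. g r x \<partial>lborel_vec (n r)) - c r)"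
      using hi by (intro sum.cong) (auto simp: has_bochner_integral_iff)
    also have "ereal \<dots> \<le> ereal (\<Sum>r=1..m. \<integral>x. g r x \<partial>lborel_vec (n r))"
      using c_nonneg by (simp add: sum_subtractf)
    also have "\<dots> = KL_states m n p y"
      using gi by (intro KL_states_eq_integral[symmetric] klg) auto
    finally show ?thesis .
  next
    case False
    then obtain r where r: "r \<in> {1..m}" and inf: "(\<integral>\<^sup>+x. ennreal (g r x) \<partial>lborel_vec (n r)) = \<infinity>"
      by auto
    have "(\<integral>\<^sup>+x. e2ennreal (kl_integrand (p r x) (y r x)) \<partial>lborel_vec (n r))
        = (\<integral>\<^sup>+x. ennreal (g r x) \<partial>lborel_vec (n r))"
      using klg[OF r] by (intro nn_integral_cong) (simp add: space_lborel_vec)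
    then have "KL_states m n p y = \<infinity>" using inf by (intro KL_states_eq_top[OF r]) simp
    then show ?thesis by simp
  qed
qed

section \<open>Moment matching\<close>

lemma pos_def_mat_det_pos:
  assumes "pos_def_mat n P"
  shows "0 < det P"
proof -
  from cholesky[OF assms] obtain L where L: "L \<in> carrier_mat n n" "P = L * transpose_mat L" by auto
  have "det P = det L * det L" using det_mult[OF L(1), of "transpose_mat L"] det_transpose[OF L(1)] L by simp
  then show ?thesis using pos_def_mat_det_nonzero[OF assms] by (simp add: zero_less_mult_iff) linarith
qed

lemma gauss_pos: "pos_def_mat n P \<Longrightarrow> 0 < gauss x a P"
  using pos_def_mat_det_pos by (simp add: gauss_def)

text \<open>The standard Gaussian serves as a witness twice: for the nonzero measure of each fibre,
  and as conditional density in modes of weight 0.\<close>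

lemma pos_def_mat_one: "pos_def_mat n (1\<^sub>m n)"
  unfolding pos_def_mat_def
proof (intro conjI ballI impI)
  fix v :: "real vec" assume v: "v \<in> carrier_vec n" "v \<noteq> 0\<^sub>v n"
  then obtain i where i: "i < n" "v $ i \<noteq> 0" by (auto simp: vec_eq_iff)
  then have "0 < v $ i * v $ i" by (simp add: zero_less_mult_iff) linarith
  also have "\<dots> \<le> (\<Sum>i<n. v $ i * v $ i)"
    using i by (intro member_le_sum[where f="\<lambda>i. v $ i * v $ i"]) auto
  finally show "0 < v \<bullet> (1\<^sub>m n *\<^sub>v v)"
    using v by (simp add: scalar_prod_def atLeast0LessThan)
qed auto

text \<open>On a null space the standard Gaussian would integrate to 0 instead of 1.\<close>

lemma emeasure_lborel_vec_carrier: "emeasure (lborel_vec n) (carrier_vec n) \<noteq> 0"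
proof
  assume "emeasure (lborel_vec n) (carrier_vec n) = 0"
  then have "AE x in lborel_vec n. gauss x (0\<^sub>v n) (1\<^sub>m n) = 0"
    by (intro AE_I'[of "space (lborel_vec n)"]) (auto simp: null_sets_def space_lborel_vec[symmetric])
  then have "(\<integral>x. gauss x (0\<^sub>v n) (1\<^sub>m n) \<partial>lborel_vec n) = 0" by (rule integral_eq_zero_AE)
  then show False
    using has_bochner_integral_gauss_1[OF pos_def_mat_one, of "0\<^sub>v n" n]
    by (simp add: has_bochner_integral_iff)
qed

lemma ln_gauss:
  assumes "pos_def_mat n P" "x \<in> carrier_vec n"
  shows "ln (gauss x a P) = - ((x - a) \<bullet> (inv_mat P *\<^sub>v (x - a))) / 2 - ln (sqrt ((2 * pi) ^ n * det P))"
  using pos_def_mat_det_pos[OF assms(1)] assms(2) by (simp add: gauss_def ln_div)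

context
  fixes n :: nat and I :: "'i set" and \<rho> :: "'i \<Rightarrow> real"
    and a :: "'i \<Rightarrow> real vec" and U :: "'i \<Rightarrow> real mat" and abar :: "real vec" and Ubar :: "real mat"
  assumes \<rho>_nonneg: "\<And>s. s \<in> I \<Longrightarrow> 0 \<le> \<rho> s" and \<rho>_sum: "(\<Sum>s\<in>I. \<rho> s) = 1"
    and a: "\<And>s. s \<in> I \<Longrightarrow> a s \<in> carrier_vec n" and U: "\<And>s. s \<in> I \<Longrightarrow> pos_def_mat n (U s)"
    and abar: "abar = vec_family_sum n (\<lambda>s. \<rho> s \<cdot>\<^sub>v a s) I"
    and Ubar: "Ubar = mat_family_sum n n (\<lambda>s. \<rho> s \<cdot>\<^sub>m outer_prod (a s - abar) (a s - abar)) I +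
        mat_family_sum n n (\<lambda>s. \<rho> s \<cdot>\<^sub>m U s) I"
begin

private lemma abar_carrier: "abar \<in> carrier_vec n"
  by (simp add: abar vec_family_sum_def)

private lemma abar_index: "i < n \<Longrightarrow> abar $ i = (\<Sum>s\<in>I. \<rho> s * a s $ i)"
  by (auto simp: abar vec_family_sum_def carrier_vecD[OF a] intro!: sum.cong)

private lemma Ubar_carrier: "Ubar \<in> carrier_mat n n"
  by (simp add: Ubar mat_family_sum_def)

private lemma Ubar_index:
  assumes "i < n" "j < n"
  shows "Ubar $$ (i, j) = (\<Sum>s\<in>I. \<rho> s * (U s $$ (i, j) + (a s $ i - abar $ i) * (a s $ j - abar $ j)))"
proof -
  have "(\<rho> s \<cdot>\<^sub>m outer_prod (a s - abar) (a s - abar)) $$ (i, j)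
      = \<rho> s * ((a s $ i - abar $ i) * (a s $ j - abar $ j))" if "s \<in> I" for s
    using a[OF that] abar_carrier assms by (simp add: outer_prod_def)
  moreover have "(\<rho> s \<cdot>\<^sub>m U s) $$ (i, j) = \<rho> s * U s $$ (i, j)" if "s \<in> I" for s
    using pos_def_matD(1)[OF U[OF that]] assms by simp
  ultimately show ?thesis
    using assms by (simp add: Ubar mat_family_sum_def sum.distrib[symmetric] distrib_left add.commute)
qed

text \<open>The parallel axis theorem: when each \<open>a s - b\<close> is split at
  \<open>abar\<close>, the cross terms vanish because the deviations from \<open>abar\<close>
  average to 0.\<close>

private lemma mixture_second_moment:
  assumes ij: "i < n" "j < n"
  shows "(\<Sum>s\<in>I. \<rho> s * (U s $$ (i, j) + (a s $ i - b $ i) * (a s $ j - b $ j)))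
    = Ubar $$ (i, j) + (abar $ i - b $ i) * (abar $ j - b $ j)"
proof -
  have centred: "(\<Sum>s\<in>I. \<rho> s * (a s $ i - abar $ i)) = 0" if "i < n" for i
    using abar_index[OF that] \<rho>_sum
    by (simp add: right_diff_distrib sum_subtractf sum_distrib_right[symmetric])
  have "(\<Sum>s\<in>I. \<rho> s * (U s $$ (i, j) + (a s $ i - b $ i) * (a s $ j - b $ j)))
      = (\<Sum>s\<in>I. \<rho> s * (U s $$ (i, j) + (a s $ i - abar $ i) * (a s $ j - abar $ j))
        + \<rho> s * (a s $ i - abar $ i) * (abar $ j - b $ j)
        + \<rho> s * (a s $ j - abar $ j) * (abar $ i - b $ i)
        + \<rho> s * ((abar $ i - b $ i) * (abar $ j - b $ j)))"
    by (intro sum.cong) (auto simp: algebra_simps)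
  also have "\<dots> = Ubar $$ (i, j) + (abar $ i - b $ i) * (abar $ j - b $ j)"
    unfolding sum.distrib sum_distrib_right[symmetric] centred[OF ij(1)] centred[OF ij(2)] \<rho>_sum
      Ubar_index[OF ij] by simp
  finally show ?thesis .
qed

text \<open>The quadratic form of \<open>Ubar\<close> is a weighted average of the forms of the
  \<open>U s\<close> plus squares coming from the spread of the means, and weights with sum 1 cannot
  all vanish.\<close>

lemma pos_def_moment_matched: "pos_def_mat n Ubar"
  unfolding pos_def_mat_def
proof (intro conjI ballI impI)
  show "Ubar \<in> carrier_mat n n" by (rule Ubar_carrier)
  show "transpose_mat Ubar = Ubar"
    using Ubar_carrier
    by (intro eq_matI)
      (auto simp: Ubar_index pos_def_mat_sym_index[OF U] mult.commute intro!: sum.cong)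
  fix v :: "real vec" assume v: "v \<in> carrier_vec n" "v \<noteq> 0\<^sub>v n"
  have "v \<bullet> (Ubar *\<^sub>v v) = (\<Sum>i<n. \<Sum>j<n. \<Sum>s\<in>I. \<rho> s * (U s $$ (i, j) * (v $ i * v $ j)
      + (v $ i * (a s $ i - abar $ i)) * (v $ j * (a s $ j - abar $ j))))"
    unfolding quad_form_sum[OF Ubar_carrier v(1)]
    by (intro sum.cong refl, subst Ubar_index)
      (auto simp: sum_distrib_right intro!: sum.cong, simp add: algebra_simps)
  also have "\<dots> = (\<Sum>i<n. \<Sum>s\<in>I. \<Sum>j<n. \<rho> s * (U s $$ (i, j) * (v $ i * v $ j)
      + (v $ i * (a s $ i - abar $ i)) * (v $ j * (a s $ j - abar $ j))))"
    by (intro sum.cong refl sum.swap)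
  also have "\<dots> = (\<Sum>s\<in>I. \<Sum>i<n. \<Sum>j<n. \<rho> s * (U s $$ (i, j) * (v $ i * v $ j)
      + (v $ i * (a s $ i - abar $ i)) * (v $ j * (a s $ j - abar $ j))))"
    by (rule sum.swap)
  also have "\<dots> = (\<Sum>s\<in>I. \<rho> s * (v \<bullet> (U s *\<^sub>v v) + (\<Sum>i<n. v $ i * (a s $ i - abar $ i))\<^sup>2))"
    using quad_form_sum[OF pos_def_matD(1)[OF U] v(1)]
    by (intro sum.cong refl)
      (simp add: sum_distrib_left[symmetric] sum.distrib power2_eq_square sum_product)
  also have "\<dots> > 0"
  proof -
    have "\<exists>s\<in>I. 0 < \<rho> s"
    proof (rule ccontr)
      assume "\<not> (\<exists>s\<in>I. 0 < \<rho> s)"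
      then have "(\<Sum>s\<in>I. \<rho> s) \<le> 0" by (intro sum_nonpos) auto
      then show False using \<rho>_sum by simp
    qed
    then obtain s where s: "s \<in> I" "0 < \<rho> s" by auto
    \<comment> \<open>A sum over an infinite set is 0 by convention, so weights with sum 1 force
      \<open>I\<close> to be finite.\<close>
    have "finite I" using \<rho>_sum by (metis sum.infinite zero_neq_one)
    then show ?thesis
      using s \<rho>_nonneg pos_def_matD(3)[OF U v] pos_def_mat_nonneg[OF U v(1)]
      by (intro sum_pos2[of I s] mult_pos_pos mult_nonneg_nonneg add_pos_nonneg add_nonneg_nonneg) auto
  qed
  finally show "0 < v \<bullet> (Ubar *\<^sub>v v)" .
qed

lemma has_bochner_integral_mixture_1:
  "has_bochner_integral (lborel_vec n) (\<lambda>x. \<Sum>s\<in>I. \<rho> s * gauss x (a s) (U s)) 1"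
proof -
  have "has_bochner_integral (lborel_vec n) (\<lambda>x. \<Sum>s\<in>I. \<rho> s * gauss x (a s) (U s)) (\<Sum>s\<in>I. \<rho> s * 1)"
    using has_bochner_integral_gauss_1 U a
    by (intro has_bochner_integral_sum has_bochner_integral_mult_right) auto
  then show ?thesis by (simp add: \<rho>_sum)
qed

text \<open>The value is the one in \<open>has_bochner_integral_gauss_quad_form\<close> for the density
  \<open>gauss x abar Ubar\<close>.\<close>
lemma has_bochner_integral_mixture_quad_form:
  assumes b: "b \<in> carrier_vec n" and B: "B \<in> carrier_mat n n"
  shows "has_bochner_integral (lborel_vec n)
    (\<lambda>x. (\<Sum>s\<in>I. \<rho> s * gauss x (a s) (U s)) * ((x - b) \<bullet> (B *\<^sub>v (x - b))))
    (\<Sum>i<n. \<Sum>j<n. B $$ (i, j) * (Ubar $$ (i, j) + (abar $ i - b $ i) * (abar $ j - b $ j)))"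
proof -
  let ?q = "\<lambda>x. (x - b) \<bullet> (B *\<^sub>v (x - b))"
  let ?v = "\<lambda>s i j. U s $$ (i, j) + (a s $ i - b $ i) * (a s $ j - b $ j)"
  have "has_bochner_integral (lborel_vec n) (\<lambda>x. \<Sum>s\<in>I. \<rho> s * (gauss x (a s) (U s) * ?q x))
      (\<Sum>s\<in>I. \<rho> s * (\<Sum>i<n. \<Sum>j<n. B $$ (i, j) * ?v s i j))"
    using U a
    by (intro has_bochner_integral_sum has_bochner_integral_mult_right
        has_bochner_integral_gauss_quad_form b B) auto
  moreover have "(\<Sum>s\<in>I. \<rho> s * (\<Sum>i<n. \<Sum>j<n. B $$ (i, j) * ?v s i j))
      = (\<Sum>i<n. \<Sum>j<n. B $$ (i, j) * (\<Sum>s\<in>I. \<rho> s * ?v s i j))"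
  proof -
    have "(\<Sum>s\<in>I. \<rho> s * (\<Sum>i<n. \<Sum>j<n. B $$ (i, j) * ?v s i j))
        = (\<Sum>s\<in>I. \<Sum>i<n. \<Sum>j<n. B $$ (i, j) * (\<rho> s * ?v s i j))"
      by (simp add: sum_distrib_left mult.left_commute)
    also have "\<dots> = (\<Sum>i<n. \<Sum>s\<in>I. \<Sum>j<n. B $$ (i, j) * (\<rho> s * ?v s i j))" by (rule sum.swap)
    also have "\<dots> = (\<Sum>i<n. \<Sum>j<n. \<Sum>s\<in>I. B $$ (i, j) * (\<rho> s * ?v s i j))"
      by (intro sum.cong refl sum.swap)
    finally show ?thesis by (simp add: sum_distrib_left)
  qed
  ultimately show ?thesis
    by (simp add: mixture_second_moment sum_distrib_right mult.assoc)
qed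

text \<open>The weights \<open>W\<close> and \<open>Y\<close> enter the log ratio only through the
  constant \<open>k\<close>, so mass and quadratic forms are all that has to agree. The common value
  is left existential: the divergence argument uses only that it is the same for both
  densities.\<close>

lemma mixture_matches_ln_ratio:
  assumes c: "c \<in> carrier_vec n" and A: "pos_def_mat n A" and W: "0 < W" and Y: "0 < Y"
  shows "\<exists>v. has_bochner_integral (lborel_vec n) (\<lambda>x. (W * (\<Sum>s\<in>I. \<rho> s * gauss x (a s) (U s)))
        * ln ((W * gauss x abar Ubar) / (Y * gauss x c A))) v \<and>
      has_bochner_integral (lborel_vec n) (\<lambda>x. (W * gauss x abar Ubar)
        * ln ((W * gauss x abar Ubar) / (Y * gauss x c A))) v"
proof -
  define k where "k = ln W - ln Y - ln (sqrt ((2 * pi) ^ n * det Ubar)) + ln (sqrt ((2 * pi) ^ n * det A))"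
  let ?q1 = "\<lambda>x. (x - c) \<bullet> (inv_mat A *\<^sub>v (x - c))"
  let ?q2 = "\<lambda>x. (x - abar) \<bullet> (inv_mat Ubar *\<^sub>v (x - abar))"
  note Ub = pos_def_moment_matched
  note iA = pos_def_inv(1)[OF A A] and iU = pos_def_inv(1)[OF Ub Ub]
  have ln_ratio: "ln ((W * gauss x abar Ubar) / (Y * gauss x c A)) = k + ?q1 x / 2 - ?q2 x / 2"
    if "x \<in> carrier_vec n" for x
    using gauss_pos[OF A, of x c] gauss_pos[OF Ub, of x abar] W Y
    by (simp add: ln_div ln_mult ln_gauss[OF A that] ln_gauss[OF Ub that] k_def field_simps)
  \<comment> \<open>Stated for a generic \<open>f\<close>, so that instantiating it with the mixture
    and with the matched Gaussian yields literally the same value.\<close>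
  have int: "has_bochner_integral (lborel_vec n)
      (\<lambda>x. (W * f x) * ln ((W * gauss x abar Ubar) / (Y * gauss x c A))) (W * (1 * k + v1 / 2 - v2 / 2))"
    if "has_bochner_integral (lborel_vec n) f 1"
      "has_bochner_integral (lborel_vec n) (\<lambda>x. f x * ?q1 x) v1"
      "has_bochner_integral (lborel_vec n) (\<lambda>x. f x * ?q2 x) v2" for f v1 v2
  proof -
    have "has_bochner_integral (lborel_vec n) (\<lambda>x. W * (f x * k + f x * ?q1 x / 2 - f x * ?q2 x / 2))
        (W * (1 * k + v1 / 2 - v2 / 2))"
      using that
      by (intro has_bochner_integral_mult_right has_bochner_integral_diff has_bochner_integral_add
          has_bochner_integral_mult_left has_bochner_integral_divide) auto
    then show ?thesis
      by (rule has_bochner_integral_cong[THEN iffD1, rotated -1])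
        (auto simp: space_lborel_vec ln_ratio algebra_simps)
  qed
  show ?thesis
    using int[OF has_bochner_integral_mixture_1 has_bochner_integral_mixture_quad_form[OF c iA]
        has_bochner_integral_mixture_quad_form[OF abar_carrier iU]]
      int[OF has_bochner_integral_gauss_1[OF Ub abar_carrier]
        has_bochner_integral_gauss_quad_form[OF Ub abar_carrier c iA]
        has_bochner_integral_gauss_quad_form[OF Ub abar_carrier abar_carrier iU]]
    by blast
qed

end

theorem theorem6:
  fixes m nz :: nat and n :: "nat \<Rightarrow> nat"
    and f0 :: "nat pmf" and \<mu> :: "nat \<Rightarrow> nat pmf"
    and x0 :: "nat \<Rightarrow> real vec" and P0 :: "nat \<Rightarrow> real mat"
    and F Q :: "nat \<Rightarrow> nat \<Rightarrow> real mat" and b :: "nat \<Rightarrow> nat \<Rightarrow> real vec"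
    and H R :: "nat \<Rightarrow> real mat" and d :: "nat \<Rightarrow> real vec" and z :: "real vec"
    and xpred zhat xupd :: "nat \<Rightarrow> nat \<Rightarrow> real vec"
    and Ppred S Pupd :: "nat \<Rightarrow> nat \<Rightarrow> real mat"
    and mode_pred :: "nat \<Rightarrow> real" and \<alpha> \<rho>' \<rho> :: "nat \<Rightarrow> nat \<Rightarrow> real"
    and state_pred f_pred lik f_post q_opt :: "nat \<Rightarrow> real vec \<Rightarrow> real"
    and xbar :: "nat \<Rightarrow> real vec" and Pbar :: "nat \<Rightarrow> real mat"
  assumes m: "1 \<le> m"
    and n: "\<And>r. r \<in> {1..m} \<Longrightarrow> 1 \<le> n r"
    and f0: "set_pmf f0 \<subseteq> {1..m}"
    and \<mu>: "\<And>s. s \<in> {1..m} \<Longrightarrow> set_pmf (\<mu> s) \<subseteq> {1..m}"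
    and x0: "\<And>s. s \<in> {1..m} \<Longrightarrow> x0 s \<in> carrier_vec (n s)"
    and P0: "\<And>s. s \<in> {1..m} \<Longrightarrow> pos_def_mat (n s) (P0 s)"
    and F: "\<And>r s. r \<in> {1..m} \<Longrightarrow> s \<in> {1..m} \<Longrightarrow> F r s \<in> carrier_mat (n r) (n s)"
    and b: "\<And>r s. r \<in> {1..m} \<Longrightarrow> s \<in> {1..m} \<Longrightarrow> b r s \<in> carrier_vec (n r)"
    and Q: "\<And>r s. r \<in> {1..m} \<Longrightarrow> s \<in> {1..m} \<Longrightarrow> Q r s \<in> carrier_mat (n r) (n r)"
    and H: "\<And>r. r \<in> {1..m} \<Longrightarrow> H r \<in> carrier_mat nz (n r)"
    and d: "\<And>r. r \<in> {1..m} \<Longrightarrow> d r \<in> carrier_vec nz"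
    and R: "\<And>r. r \<in> {1..m} \<Longrightarrow> pos_def_mat nz (R r)"
    and z: "z \<in> carrier_vec nz"
    and xpred: "\<And>r s. xpred r s = F r s *\<^sub>v x0 s + b r s"
    and Ppred: "\<And>r s. Ppred r s = F r s * P0 s * transpose_mat (F r s) + Q r s"
    and Ppred_pos: "\<And>r s. r \<in> {1..m} \<Longrightarrow> s \<in> {1..m} \<Longrightarrow> pos_def_mat (n r) (Ppred r s)"
    and mode_pred: "\<And>r. mode_pred r = (\<Sum>s=1..m. pmf (\<mu> s) r * pmf f0 s)"
    and \<alpha>: "\<And>r s. \<alpha> r s = pmf (\<mu> s) r * pmf f0 s / (\<Sum>s'=1..m. pmf (\<mu> s') r * pmf f0 s')"
    and state_pred: "\<And>r x. state_pred r x = (\<Sum>s=1..m. \<alpha> r s * gauss x (xpred r s) (Ppred r s))"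
    and f_pred: "\<And>r x. f_pred r x = mode_pred r * state_pred r x"
    and lik: "\<And>r x. lik r x = gauss z (H r *\<^sub>v x + d r) (R r)"
    and f_post: "\<And>r x. f_post r x =
          lik r x * f_pred r x / (\<Sum>r'=1..m. \<integral>y. lik r' y * f_pred r' y \<partial>lborel_vec (n r'))"
    and zhat: "\<And>r s. zhat r s = H r *\<^sub>v xpred r s + d r"
    and S: "\<And>r s. S r s = H r * Ppred r s * transpose_mat (H r) + R r"
    and xupd: "\<And>r s. xupd r s = xpred r s +
          (Ppred r s * transpose_mat (H r) * inv_mat (S r s)) *\<^sub>v (z - zhat r s)"
    and Pupd: "\<And>r s. Pupd r s = Ppred r s -
          Ppred r s * transpose_mat (H r) * inv_mat (S r s) * H r * Ppred r s"
    and \<rho>': "\<And>r s. \<rho>' r s = gauss z (zhat r s) (S r s) * pmf (\<mu> s) r * pmf f0 s"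
    and \<rho>: "\<And>r s. \<rho> r s = \<rho>' r s / (\<Sum>s'=1..m. \<rho>' r s')"
    and xbar: "\<And>r. xbar r = vec_family_sum (n r) (\<lambda>s. \<rho> r s \<cdot>\<^sub>v xupd r s) {1..m}"
    and Pbar: "\<And>r. Pbar r =
          mat_family_sum (n r) (n r)
            (\<lambda>s. \<rho> r s \<cdot>\<^sub>m outer_prod (xupd r s - xbar r) (xupd r s - xbar r)) {1..m} +
          mat_family_sum (n r) (n r) (\<lambda>s. \<rho> r s \<cdot>\<^sub>m Pupd r s) {1..m}"
    and q_opt: "\<And>r x. q_opt r x = mode_marginal n f_post r * gauss x (xbar r) (Pbar r)"
  shows "(\<forall>r\<in>{1..m}. mode_pred r > 0 \<longrightarrow>
            xbar r \<in> carrier_vec (n r) \<and> pos_def_mat (n r) (Pbar r)) \<and>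
         (\<forall>r\<in>{1..m}. mode_marginal n f_post r =
            (\<Sum>s=1..m. \<rho>' r s) / (\<Sum>r'=1..m. \<Sum>s=1..m. \<rho>' r' s)) \<and>
         is_arg_min (KL_states m n f_post) (mode_gaussian_density m n) q_opt"
proof -
  \<comment> \<open>\<open>w r\<close> will be the integral of likelihood times prediction over mode
    \<open>r\<close>, and \<open>c\<close> the denominator in Bayes' rule.\<close>
  define w where "w r = (\<Sum>s=1..m. \<rho>' r s)" for r
  define c where "c = (\<Sum>r=1..m. w r)"
  have xpred_c: "xpred r s \<in> carrier_vec (n r)" if "r \<in> {1..m}" "s \<in> {1..m}" for r s
    using mult_mat_vec_carrier[OF F[OF that] x0[OF that(2)]] b[OF that] by (simp add: xpred)
  have S_pos: "pos_def_mat nz (S r s)" and U_pos: "pos_def_mat (n r) (Pupd r s)"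
    if "r \<in> {1..m}" "s \<in> {1..m}" for r s
    using pos_def_innovation[OF Ppred_pos[OF that] H[OF that(1)] R[OF that(1)] S]
      pos_def_kalman_update[OF Ppred_pos[OF that] H[OF that(1)] R[OF that(1)] S Pupd] by auto
  have xupd_c: "xupd r s \<in> carrier_vec (n r)" if "r \<in> {1..m}" "s \<in> {1..m}" for r s
    using pos_def_matD(1)[OF Ppred_pos[OF that]] unfolding xupd[of r s] by (intro carrier_vecI) simp

  \<comment> \<open>The posterior, component by component\<close>
  have update: "lik r x * gauss x (xpred r s) (Ppred r s)
      = gauss z (zhat r s) (S r s) * gauss x (xupd r s) (Pupd r s)"
    if "r \<in> {1..m}" "s \<in> {1..m}" "x \<in> carrier_vec (n r)" for r s x
    unfolding lik xupd zhat
    by (rule gauss_kalman_update[OF Ppred_pos[OF that(1,2)] H[OF that(1)] R[OF that(1)] S Pupd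
          that(3) z xpred_c[OF that(1,2)] d[OF that(1)]])
  have \<rho>'_nonneg: "0 \<le> \<rho>' r s" if "r \<in> {1..m}" "s \<in> {1..m}" for r s
    using gauss_pos[OF S_pos[OF that], of z "zhat r s"] by (simp add: \<rho>')
  have \<rho>'_pos: "0 < \<rho>' r s" if "r \<in> {1..m}" "s \<in> {1..m}" "0 < pmf (\<mu> s) r * pmf f0 s" for r s
    using gauss_pos[OF S_pos[OF that(1,2)], of z "zhat r s"] that(3) by (simp add: \<rho>' mult.assoc)
  have w_nonneg: "0 \<le> w r" if "r \<in> {1..m}" for r
    unfolding w_def using \<rho>'_nonneg[OF that] by (intro sum_nonneg) auto
  have w_pos: "0 < w r" if r: "r \<in> {1..m}" and "s \<in> {1..m}" "0 < pmf (\<mu> s) r * pmf f0 s" for r s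
    unfolding w_def using \<rho>'_pos[OF that] \<rho>'_nonneg[OF r] that(2) by (intro sum_pos2[of _ s]) auto
  \<comment> \<open>If the predicted mode probability is 0, then \<open>\<alpha> r s\<close> is a
    division by 0; the identity survives because every summand of \<open>mode_pred r\<close>
    vanishes.\<close>
  have mode_alpha: "mode_pred r * \<alpha> r s = pmf (\<mu> s) r * pmf f0 s" if "s \<in> {1..m}" for r s
  proof (cases "mode_pred r = 0")
    case True
    then have "pmf (\<mu> s) r * pmf f0 s = 0"
      using that sum_nonneg_eq_0_iff[of "{1..m}" "\<lambda>s. pmf (\<mu> s) r * pmf f0 s"]
      by (auto simp: mode_pred)
    then show ?thesis using True by simp
  next
    case False
    then show ?thesis by (simp add: \<alpha> mode_pred)
  qed
  have joint: "lik r x * f_pred r x = (\<Sum>s=1..m. \<rho>' r s * gauss x (xupd r s) (Pupd r s))"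
    if r: "r \<in> {1..m}" and x: "x \<in> carrier_vec (n r)" for r x
  proof -
    have "lik r x * f_pred r x
        = (\<Sum>s=1..m. mode_pred r * \<alpha> r s * (lik r x * gauss x (xpred r s) (Ppred r s)))"
      by (simp add: f_pred state_pred sum_distrib_left mult_ac)
    also have "\<dots> = (\<Sum>s=1..m. \<rho>' r s * gauss x (xupd r s) (Pupd r s))"
      using r x by (intro sum.cong) (auto simp: update mode_alpha \<rho>')
    finally show ?thesis .
  qed
  have joint_int: "has_bochner_integral (lborel_vec (n r)) (\<lambda>x. lik r x * f_pred r x) (w r)"
    if r: "r \<in> {1..m}" for r
  proof -
    have "has_bochner_integral (lborel_vec (n r))
        (\<lambda>x. \<Sum>s=1..m. \<rho>' r s * gauss x (xupd r s) (Pupd r s)) (\<Sum>s=1..m. \<rho>' r s * 1)"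
      using has_bochner_integral_gauss_1[OF U_pos[OF r] xupd_c[OF r]]
      by (intro has_bochner_integral_sum has_bochner_integral_mult_right) auto
    then show ?thesis
      by (subst has_bochner_integral_cong[OF refl joint[OF r] refl])
        (auto simp: space_lborel_vec w_def)
  qed
  have c_eq: "(\<Sum>r=1..m. \<integral>y. lik r y * f_pred r y \<partial>lborel_vec (n r)) = c"
    unfolding c_def using joint_int by (intro sum.cong) (auto simp: has_bochner_integral_iff)
  \<comment> \<open>A mode charged by \<open>f0\<close> and a successor charged by its transition
    law give a strictly positive summand.\<close>
  have c_pos: "0 < c"
  proof -
    obtain s where "s \<in> set_pmf f0" using set_pmf_not_empty[of f0] by blast
    then have s: "s \<in> {1..m}" "0 < pmf f0 s" using f0 pmf_positive by auto
    obtain r where "r \<in> set_pmf (\<mu> s)" using set_pmf_not_empty[of "\<mu> s"] by blast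
    then have r: "r \<in> {1..m}" "0 < pmf (\<mu> s) r" using \<mu>[OF s(1)] pmf_positive by auto
    show ?thesis
      unfolding c_def using w_pos[OF r(1) s(1)] r s w_nonneg by (intro sum_pos2[of _ r]) auto
  qed
  have \<rho>_eq: "\<rho> r s = \<rho>' r s / w r" for r s unfolding \<rho> w_def ..
  define W where "W r = w r / c" for r
  have f_post_eq: "f_post r x = lik r x * f_pred r x / c" for r x
    unfolding f_post c_eq ..
  have f_post_int: "has_bochner_integral (lborel_vec (n r)) (f_post r) (W r)" if "r \<in> {1..m}" for r
    using has_bochner_integral_divide[OF joint_int[OF that], of c] c_pos
    by (simp add: f_post_eq[abs_def] W_def)
  have marginal: "mode_marginal n f_post r = W r" if "r \<in> {1..m}" for r
    using f_post_int[OF that] by (simp add: mode_marginal_def has_bochner_integral_iff)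
  have W_nonneg: "0 \<le> W r" if "r \<in> {1..m}" for r using w_nonneg[OF that] c_pos by (simp add: W_def)
  have W_sum: "(\<Sum>r=1..m. W r) = 1"
    using c_pos unfolding W_def sum_divide_distrib[symmetric] c_def[symmetric] by simp
  \<comment> \<open>Positive weight is required because \<open>\<rho>\<close> divides by
    \<open>w r\<close>. In the remaining modes all \<open>\<rho>'\<close> vanish and with them the
    posterior, pointwise.\<close>
  have f_post_mix: "f_post r x = W r * (\<Sum>s\<in>{1..m}. \<rho> r s * gauss x (xupd r s) (Pupd r s))"
    if "r \<in> {1..m}" "x \<in> carrier_vec (n r)" "0 < W r" for r x
  proof -
    have "0 < w r" using that(3) c_pos by (simp add: W_def zero_less_divide_iff)
    then show ?thesis
      unfolding f_post_eq joint[OF that(1,2)] W_def \<rho>_eq sum_distrib_left sum_divide_distrib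
      by (intro sum.cong) auto
  qed
  have f_post_null: "f_post r x = 0" if "r \<in> {1..m}" "x \<in> carrier_vec (n r)" "\<not> 0 < W r" for r x
  proof -
    have "w r = 0" using that(3) w_nonneg[OF that(1)] c_pos by (simp add: W_def zero_less_divide_iff)
    then have "\<forall>s\<in>{1..m}. \<rho>' r s = 0"
      using \<rho>'_nonneg[OF that(1)] sum_nonneg_eq_0_iff[of "{1..m}" "\<rho>' r"] by (auto simp: w_def)
    then show ?thesis by (simp add: f_post_eq joint[OF that(1,2)])
  qed
  have \<rho>_nonneg: "0 \<le> \<rho> r s" if "r \<in> {1..m}" "s \<in> {1..m}" for r s
    using \<rho>'_nonneg[OF that] w_nonneg[OF that(1)] by (simp add: \<rho>_eq)
  have \<rho>_sum: "(\<Sum>s\<in>{1..m}. \<rho> r s) = 1" if "0 < W r" for r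
    using that unfolding \<rho>_eq sum_divide_distrib[symmetric] w_def[symmetric] W_def by auto

  \<comment> \<open>The moment matched density\<close>
  have xbar_c: "xbar r \<in> carrier_vec (n r)" for r by (simp add: xbar vec_family_sum_def)
  have Pbar_pos: "pos_def_mat (n r) (Pbar r)" if "r \<in> {1..m}" "0 < W r" for r
    using pos_def_moment_matched[OF \<rho>_nonneg[OF that(1)] \<rho>_sum[OF that(2)] xupd_c[OF that(1)]
        U_pos[OF that(1)] xbar Pbar] by simp
  \<comment> \<open>A Gaussian likelihood vanishes nowhere, so a mode of positive predicted
    probability keeps positive posterior probability. This links the condition in the statement to
    the condition \<open>0 < W r\<close> used throughout the proof.\<close>
  have W_pos: "0 < W r" if r: "r \<in> {1..m}" and "0 < mode_pred r" for r
  proof -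
    have "\<exists>s\<in>{1..m}. 0 < pmf (\<mu> s) r * pmf f0 s"
      using that(2) sum_nonpos[of "{1..m}" "\<lambda>s. pmf (\<mu> s) r * pmf f0 s"]
      by (force simp: mode_pred not_less)
    then show ?thesis using w_pos[OF r] c_pos by (auto simp: W_def)
  qed
  have f_post_density: "state_density m n f_post"
  proof (rule state_densityI[OF f_post_int _ W_sum])
    fix r and x :: "real vec" assume r: "r \<in> {1..m}" and x: "x \<in> carrier_vec (n r)"
    show "0 \<le> f_post r x"
      unfolding f_post_eq joint[OF r x] using c_pos \<rho>'_nonneg[OF r] gauss_pos[OF U_pos[OF r]]
      by (intro divide_nonneg_pos sum_nonneg mult_nonneg_nonneg) (auto intro: less_imp_le)
  qed
  have q_opt_eq: "q_opt r x = W r * gauss x (xbar r) (Pbar r)" if "r \<in> {1..m}" for r x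
    by (simp add: q_opt marginal[OF that])
  have q_opt_int: "has_bochner_integral (lborel_vec (n r)) (q_opt r) (W r)" if r: "r \<in> {1..m}" for r
  proof (cases "0 < W r")
    case True
    have "has_bochner_integral (lborel_vec (n r)) (\<lambda>x. W r * gauss x (xbar r) (Pbar r)) (W r * 1)"
      by (intro has_bochner_integral_mult_right has_bochner_integral_gauss_1 Pbar_pos r True xbar_c)
    then show ?thesis by (simp add: q_opt_eq[OF r, abs_def])
  next
    case False
    then have "W r = 0" using W_nonneg[OF r] by simp
    then show ?thesis by (simp add: q_opt_eq[OF r, abs_def] has_bochner_integral_zero)
  qed
  have q_opt_density: "state_density m n q_opt"
  proof (rule state_densityI[OF q_opt_int _ W_sum])
    fix r and x :: "real vec" assume r: "r \<in> {1..m}"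
    show "0 \<le> q_opt r x"
      using W_nonneg[OF r] gauss_pos[OF Pbar_pos[OF r], of x "xbar r"]
      by (cases "0 < W r") (auto simp: q_opt_eq[OF r] less_imp_le)
  qed
  have q_opt_marginal: "mode_marginal n q_opt r = W r" if "r \<in> {1..m}" for r
    using q_opt_int[OF that] by (simp add: mode_marginal_def has_bochner_integral_iff)
  have q_opt_gaussian: "mode_gaussian_density m n q_opt"
    unfolding mode_gaussian_density_def
  proof (intro conjI exI ballI q_opt_density)
    \<comment> \<open>In a mode of weight 0 the matrix \<open>Pbar r\<close> need not be positive
      definite; any Gaussian may stand in, since it is multiplied by 0.\<close>
    let ?\<kappa> = "\<lambda>r x. if 0 < W r then gauss x (xbar r) (Pbar r) else gauss x (0\<^sub>v (n r)) (1\<^sub>m (n r))"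
    fix r assume r: "r \<in> {1..m}"
    show "gaussian_density_vec (n r) (?\<kappa> r)"
    proof (cases "0 < W r")
      case True
      then show ?thesis using xbar_c Pbar_pos[OF r] by (auto simp: gaussian_density_vec_def)
    next
      case False
      then show ?thesis
        unfolding gaussian_density_vec_def
        by (intro exI[of _ "0\<^sub>v (n r)"] exI[of _ "1\<^sub>m (n r)"]) (auto simp: pos_def_mat_one)
    qed
    fix x :: "real vec"
    show "q_opt r x = mode_marginal n q_opt r * ?\<kappa> r x"
      using W_nonneg[OF r] by (auto simp: q_opt_marginal[OF r] q_opt_eq[OF r])
  qed

  \<comment> \<open>Comparison with an arbitrary competitor\<close>
  have optimal: "KL_states m n f_post q_opt \<le> KL_states m n f_post y"
    if y: "mode_gaussian_density m n y" for y
  proof -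
    define Y where "Y = mode_marginal n y"
    from y obtain \<kappa> where y_density: "state_density m n y"
      and \<kappa>: "\<And>r. r \<in> {1..m} \<Longrightarrow> gaussian_density_vec (n r) (\<kappa> r)"
      and y_eq: "\<And>r x. r \<in> {1..m} \<Longrightarrow> x \<in> carrier_vec (n r) \<Longrightarrow> y r x = Y r * \<kappa> r x"
      unfolding mode_gaussian_density_def Y_def by blast
    from \<kappa> have "\<forall>r\<in>{1..m}. \<exists>a A. a \<in> carrier_vec (n r) \<and> pos_def_mat (n r) A \<and>
        (\<forall>x\<in>carrier_vec (n r). \<kappa> r x = gauss x a A)"
      by (simp add: gaussian_density_vec_def)
    then obtain a A where a: "\<And>r. r \<in> {1..m} \<Longrightarrow> a r \<in> carrier_vec (n r)"
      and A: "\<And>r. r \<in> {1..m} \<Longrightarrow> pos_def_mat (n r) (A r)"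
      and \<kappa>_eq: "\<And>r x. r \<in> {1..m} \<Longrightarrow> x \<in> carrier_vec (n r) \<Longrightarrow> \<kappa> r x = gauss x (a r) (A r)"
      by metis
    have Y_nonneg: "0 \<le> Y r" if "r \<in> {1..m}" for r
      unfolding Y_def mode_marginal_def using state_densityD(2)[OF y_density that]
      by (intro integral_nonneg_AE AE_I2) (simp add: space_lborel_vec)
    have mix_pos: "0 < f_post r x" if r: "r \<in> {1..m}" and x: "x \<in> carrier_vec (n r)" and "0 < W r" for r x
    proof -
      have "\<exists>s\<in>{1..m}. 0 < \<rho>' r s"
      proof (rule ccontr)
        assume "\<not> ?thesis"
        then have "w r \<le> 0" unfolding w_def by (intro sum_nonpos) (meson not_less)
        then show False using that(3) c_pos by (simp add: W_def zero_less_divide_iff)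
      qed
      then obtain s where "s \<in> {1..m}" "0 < \<rho>' r s" by auto
      then have "0 < (\<Sum>s=1..m. \<rho>' r s * gauss x (xupd r s) (Pupd r s))"
        using \<rho>'_nonneg[OF r] gauss_pos[OF U_pos[OF r]] less_imp_le[OF gauss_pos[OF U_pos[OF r]]]
        by (intro sum_pos2[of _ s]) (auto intro!: mult_nonneg_nonneg mult_pos_pos)
      then show ?thesis using c_pos by (simp add: f_post_eq joint[OF r x])
    qed
    show ?thesis
    proof (cases "\<exists>r\<in>{1..m}. 0 < W r \<and> Y r = 0")
      case True
      then obtain r where r: "r \<in> {1..m}" "0 < W r" "Y r = 0" by auto
      \<comment> \<open>The posterior is strictly positive on the whole fibre of a mode it charges,
        whereas the competitor is 0 there.\<close>
      have "KL_states m n f_post y = \<infinity>"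
        using r mix_pos[OF r(1) _ r(2)] y_eq[OF r(1)]
        by (intro KL_states_eq_top_of_null_mode[OF r(1) emeasure_lborel_vec_carrier]) force
      then show ?thesis by simp
    next
      case False
      then have Y_pos: "0 < Y r" if "r \<in> {1..m}" "0 < W r" for r
        using that Y_nonneg[OF that(1)] by (auto simp: less_le)
      have "\<exists>v. has_bochner_integral (lborel_vec (n r)) (\<lambda>x. f_post r x * ln (q_opt r x / y r x)) v \<and>
          has_bochner_integral (lborel_vec (n r)) (\<lambda>x. q_opt r x * ln (q_opt r x / y r x)) v"
        if r: "r \<in> {1..m}" for r
      proof (cases "0 < W r")
        case True
        have y_gauss: "y r x = Y r * gauss x (a r) (A r)" if "x \<in> carrier_vec (n r)" for x
          using y_eq[OF r that] \<kappa>_eq[OF r that] by simp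
        obtain v where v1:
          "has_bochner_integral (lborel_vec (n r))
            (\<lambda>x. (W r * (\<Sum>s\<in>{1..m}. \<rho> r s * gauss x (xupd r s) (Pupd r s)))
              * ln ((W r * gauss x (xbar r) (Pbar r)) / (Y r * gauss x (a r) (A r)))) v"
          and v2: "has_bochner_integral (lborel_vec (n r)) (\<lambda>x. (W r * gauss x (xbar r) (Pbar r))
              * ln ((W r * gauss x (xbar r) (Pbar r)) / (Y r * gauss x (a r) (A r)))) v"
          using mixture_matches_ln_ratio[OF \<rho>_nonneg[OF r] \<rho>_sum[OF True] xupd_c[OF r]
              U_pos[OF r] xbar Pbar a[OF r] A[OF r] True Y_pos[OF r True]] by auto
        have "has_bochner_integral (lborel_vec (n r)) (\<lambda>x. f_post r x * ln (q_opt r x / y r x)) v"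
          by (rule has_bochner_integral_cong[THEN iffD2, OF refl _ refl v1])
            (simp add: space_lborel_vec f_post_mix[OF r _ True] q_opt_eq[OF r] y_gauss)
        moreover have "has_bochner_integral (lborel_vec (n r)) (\<lambda>x. q_opt r x * ln (q_opt r x / y r x)) v"
          by (rule has_bochner_integral_cong[THEN iffD2, OF refl _ refl v2])
            (simp add: space_lborel_vec q_opt_eq[OF r] y_gauss)
        ultimately show ?thesis by blast
      next
        case False
        then have W: "W r = 0" using W_nonneg[OF r] by simp
        \<comment> \<open>Posterior and approximation both vanish in this mode, so the common value
          is 0 whatever the competitor does there.\<close>
        have "has_bochner_integral (lborel_vec (n r)) (\<lambda>x. f_post r x * ln (q_opt r x / y r x)) 0"
          by (rule has_bochner_integral_cong[THEN iffD2, OF refl _ refl has_bochner_integral_zero])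
            (simp add: space_lborel_vec f_post_null[OF r _ False])
        moreover have "has_bochner_integral (lborel_vec (n r)) (\<lambda>x. q_opt r x * ln (q_opt r x / y r x)) 0"
          by (simp add: q_opt_eq[OF r] W has_bochner_integral_zero)
        ultimately show ?thesis by blast
      qed
      then have "\<forall>r\<in>{1..m}. \<exists>v.
          has_bochner_integral (lborel_vec (n r)) (\<lambda>x. f_post r x * ln (q_opt r x / y r x)) v \<and>
          has_bochner_integral (lborel_vec (n r)) (\<lambda>x. q_opt r x * ln (q_opt r x / y r x)) v"
        by (rule ballI)
      from bchoice[OF this] obtain v where v: "\<forall>r\<in>{1..m}.
          has_bochner_integral (lborel_vec (n r)) (\<lambda>x. f_post r x * ln (q_opt r x / y r x)) (v r) \<and>
          has_bochner_integral (lborel_vec (n r)) (\<lambda>x. q_opt r x * ln (q_opt r x / y r x)) (v r)"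
        by (rule exE)
      show ?thesis
      proof (rule KL_states_le_of_matching[OF f_post_density q_opt_density y_density _
            bspec[OF v, THEN conjunct1] bspec[OF v, THEN conjunct2]])
        fix r and x :: "real vec" assume r: "r \<in> {1..m}" and x: "x \<in> carrier_vec (n r)"
        show "(f_post r x = 0 \<longleftrightarrow> q_opt r x = 0) \<and> (y r x = 0 \<longrightarrow> f_post r x = 0)"
        proof (cases "0 < W r")
          case True
          then show ?thesis
            using mix_pos[OF r x] Y_pos[OF r] gauss_pos[OF A[OF r], of x "a r"]
              gauss_pos[OF Pbar_pos[OF r], of x "xbar r"]
            by (auto simp: q_opt_eq[OF r] y_eq[OF r x] \<kappa>_eq[OF r x])
        next
          case False
          then show ?thesis
            using W_nonneg[OF r] f_post_null[OF r x] by (simp add: q_opt_eq[OF r])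
        qed
      qed
    qed
  qed
  show ?thesis
  proof (intro conjI ballI impI)
    fix r assume "r \<in> {1..m}"
    then show "mode_marginal n f_post r = (\<Sum>s=1..m. \<rho>' r s) / (\<Sum>r'=1..m. \<Sum>s=1..m. \<rho>' r' s)"
      by (simp add: marginal W_def c_def w_def)
  next
    show "is_arg_min (KL_states m n f_post) (mode_gaussian_density m n) q_opt"
      using q_opt_gaussian optimal by (auto simp: is_arg_min_def not_less)
  qed (use xbar_c Pbar_pos W_pos in auto)
qed

end
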